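(* Let $A:[0,+\infty)\to M_{n\times n}(\mathbb{R})$ and $B:[0,+\infty)\to M_{n\times p}(\mathbb{R})$ be measurable and bounded on finite intervals, and let $L:[0,+\infty)\to M_{p\times n}(\mathbb{R})$ be measurable. Assume that the system $\dot x(t)=A(t)x(t)$ (the plant of $(A,B)$) admits nonuniform bounded growth on $[0,+\infty)$ with constants $K_0>0$, $a>0$ and $\varepsilon>0$. Suppose there are constants $\mathcal{L}>0$, $\ell>0$, $\mathcal{B}>0$, $\beta>0$ such that for all $z\ge0$ $$\|L^T(z)\|\le\mathcal{L}e^{\ell z},\qquad \|B^T(z)\|\le\mathcal{B}e^{-\beta z},$$ and $$\beta-(\varepsilon+\ell)>0 .$$ Then the system $(A,B)$, i.e. $\dot x(t)=A(t)x(t)+B(t)u(t)$, is nonuniformly completely controllable if and only if the system $(A-BL,B)$, i.e. $\dot x(t)=(A(t)-B(t)L(t))x(t)+B(t)u(t)$, is nonuniformly completely controllable.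
   Context: Vectors carry the Euclidean norm and $\|\cdot\|$ on matrices is the induced operator norm. For symmetric matrices, $M\le N$ means $N-M$ is positive semidefinite; $I$ is the identity matrix. For a measurable, locally bounded $A:[0,+\infty)\to M_{n\times n}(\mathbb{R})$, $\Phi_A(t,s)$ ($t,s\ge 0$) denotes the transition matrix of $\dot x(t)=A(t)x(t)$ (solutions satisfy $x(t)=\Phi_A(t,s)x(s)$). Nonuniform bounded growth: the system $\dot x=A(t)x$ admits nonuniform bounded growth on $[0,+\infty)$ with constants $K_0>0$, $a>0$, $\varepsilon>0$ if $$\|\Phi_A(t,\tau)\|\le K_0e^{\varepsilon\tau}e^{a|t-\tau|}\quad\text{for all } t,\tau\ge 0 .$$ Nonuniform complete controllability (NUCC): for a pair $(A,B)$, i.e. the control system $\dot x=A(t)x+B(t)u$, let $$W(t_0,t_1)=\int_{t_0}^{t_1}\Phi_A(t_0,s)B(s)B^T(s)\Phi_A^T(t_0,s)\,ds,$$ $$K(t,t+\sigma)=\Phi_A(t+\sigma,t)W(t,t+\sigma)\Phi_A^T(t+\sigma,t).$$ The pair $(A,B)$ is nonuniformly completely controllable if there exist fixed numbers $\mu_0,\mu_1,\tilde\mu_0,\tilde\mu_1\ge 0$ and functions $\alpha_0,\beta_0,\alpha_1,\beta_1:[0,+\infty)\to(0,+\infty)$ such that for any $t\ge 0$ there exists $\sigma_0(t)>0$ with $$e^{-2\mu_0t}\alpha_0(\sigma)I\le W(t,t+\sigma)\le e^{2\mu_1t}\alpha_1(\sigma)I,$$ $$e^{-2\tilde\mu_0t}\beta_0(\sigma)I\le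 K(t,t+\sigma)\le e^{2\tilde\mu_1t}\beta_1(\sigma)I$$ for every $\sigma\ge\sigma_0(t)$. *)

theory Defs
  imports "HOL-Analysis.Analysis"
begin

text \<open>Functions on \<open>[0,\<infinity>)\<close> are total functions on \<^typ>\<open>real\<close> whose values at negative arguments
  are never used. An \<open>m\<close>-by-\<open>k\<close> matrix has type \<open>real^'k^'m\<close>. The library norm of a matrix is the
  Frobenius norm, so the operator norm induced by the Euclidean norm is
  \<open>onorm ((*v) M)\<close>.\<close>

abbreviation matrix_onorm :: "real^'k^'m \<Rightarrow> real" where
  "matrix_onorm M \<equiv> onorm ((*v) M)"

definition measurable_halfline :: "(real \<Rightarrow> real^'k^'m) \<Rightarrow> bool" where
  "measurable_halfline F \<longleftrightarrow> F \<in> borel_measurable (lebesgue_on {0..})"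

definition locally_bounded_halfline :: "(real \<Rightarrow> real^'k^'m) \<Rightarrow> bool" where
  "locally_bounded_halfline F \<longleftrightarrow> (\<forall>T\<ge>0. bounded (F ` {0..T}))"

definition pos_semidef :: "real^'n^'n \<Rightarrow> bool" where
  "pos_semidef M \<longleftrightarrow> transpose M = M \<and> (\<forall>x. 0 \<le> x \<bullet> (M *v x))"

definition loewner_le :: "real^'n^'n \<Rightarrow> real^'n^'n \<Rightarrow> bool"  (infix "\<preceq>" 50) where
  "M \<preceq> N \<longleftrightarrow> pos_semidef (N - M)"

text \<open>Since \<open>A\<close> is only measurable, solutions of \<open>x'(t) = A(t) x(t)\<close> are meant in the sense of
  Caratheodory, i.e. as solutions of the integral equation. (For \<open>A\<close> measurable and locally bounded
  the integrand is bounded and measurable on compact intervals, so the gauge integral used here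
  is a Lebesgue integral.)\<close>

definition solves_linear_ode :: "(real \<Rightarrow> real^'n^'n) \<Rightarrow> (real \<Rightarrow> real^'n) \<Rightarrow> bool" where
  "solves_linear_ode A x \<longleftrightarrow>
     continuous_on {0..} x \<and>
     (\<forall>s t. 0 \<le> s \<and> s \<le> t \<longrightarrow> ((\<lambda>r. A r *v x r) has_integral (x t - x s)) {s..t})"

definition transition_matrix :: "(real \<Rightarrow> real^'n^'n) \<Rightarrow> real \<Rightarrow> real \<Rightarrow> real^'n^'n" where
  "transition_matrix A t s = (THE M. \<forall>x. solves_linear_ode A x \<longrightarrow> x t = M *v x s)"

definition nonuniform_bounded_growth ::
    "(real \<Rightarrow> real^'n^'n) \<Rightarrow> real \<Rightarrow> real \<Rightarrow> real \<Rightarrow> bool" where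
  "nonuniform_bounded_growth A K\<^sub>0 a \<epsilon> \<longleftrightarrow>
     K\<^sub>0 > 0 \<and> a > 0 \<and> \<epsilon> > 0 \<and>
     (\<forall>t\<ge>0. \<forall>\<tau>\<ge>0.
        matrix_onorm (transition_matrix A t \<tau>) \<le> K\<^sub>0 * exp (\<epsilon> * \<tau>) * exp (a * \<bar>t - \<tau>\<bar>))"

definition gramian_W ::
    "(real \<Rightarrow> real^'n^'n) \<Rightarrow> (real \<Rightarrow> real^'p^'n) \<Rightarrow> real \<Rightarrow> real \<Rightarrow> real^'n^'n" where
  "gramian_W A B t\<^sub>0 t\<^sub>1 =
     integral {t\<^sub>0..t\<^sub>1} (\<lambda>s. transition_matrix A t\<^sub>0 s ** B s ** transpose (B s)
                              ** transpose (transition_matrix A t\<^sub>0 s))"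

definition gramian_K ::
    "(real \<Rightarrow> real^'n^'n) \<Rightarrow> (real \<Rightarrow> real^'p^'n) \<Rightarrow> real \<Rightarrow> real \<Rightarrow> real^'n^'n" where
  "gramian_K A B t\<^sub>0 t\<^sub>1 =
     transition_matrix A t\<^sub>1 t\<^sub>0 ** gramian_W A B t\<^sub>0 t\<^sub>1 ** transpose (transition_matrix A t\<^sub>1 t\<^sub>0)"

definition nonuniformly_completely_controllable ::
    "(real \<Rightarrow> real^'n^'n) \<Rightarrow> (real \<Rightarrow> real^'p^'n) \<Rightarrow> bool" where
  "nonuniformly_completely_controllable A B \<longleftrightarrow>
     (\<exists>\<mu>\<^sub>0 \<mu>\<^sub>1 \<nu>\<^sub>0 \<nu>\<^sub>1 :: real. \<exists>\<alpha>\<^sub>0 \<beta>\<^sub>0 \<alpha>\<^sub>1 \<beta>\<^sub>1 :: real \<Rightarrow> real.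
        \<mu>\<^sub>0 \<ge> 0 \<and> \<mu>\<^sub>1 \<ge> 0 \<and> \<nu>\<^sub>0 \<ge> 0 \<and> \<nu>\<^sub>1 \<ge> 0 \<and>
        (\<forall>\<sigma>\<ge>0. \<alpha>\<^sub>0 \<sigma> > 0 \<and> \<beta>\<^sub>0 \<sigma> > 0 \<and> \<alpha>\<^sub>1 \<sigma> > 0 \<and> \<beta>\<^sub>1 \<sigma> > 0) \<and>
        (\<forall>t\<ge>0. \<exists>\<sigma>\<^sub>0>0. \<forall>\<sigma>\<ge>\<sigma>\<^sub>0.
           (exp (- 2 * \<mu>\<^sub>0 * t) * \<alpha>\<^sub>0 \<sigma>) *\<^sub>R mat 1 \<preceq> gramian_W A B t (t + \<sigma>) \<and>
           gramian_W A B t (t + \<sigma>) \<preceq> (exp (2 * \<mu>\<^sub>1 * t) * \<alpha>\<^sub>1 \<sigma>) *\<^sub>R mat 1 \<and>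
           (exp (- 2 * \<nu>\<^sub>0 * t) * \<beta>\<^sub>0 \<sigma>) *\<^sub>R mat 1 \<preceq> gramian_K A B t (t + \<sigma>) \<and>
           gramian_K A B t (t + \<sigma>) \<preceq> (exp (2 * \<nu>\<^sub>1 * t) * \<beta>\<^sub>1 \<sigma>) *\<^sub>R mat 1))"

end

theory Submission
  imports Defs
begin

text \<open>The Gramian \<open>W\<close> has the quadratic form \<open>x \<mapsto> \<integral> |B(s)\<^sup>T \<Phi>(t,s)\<^sup>T x|\<^sup>2 ds\<close>. By variation of constants, the
  functions \<open>s \<mapsto> B(s)\<^sup>T \<Phi>(t,s)\<^sup>T x\<close> of the two systems differ by a Volterra operator with kernel
  \<open>B(s)\<^sup>T \<Phi>(r,s)\<^sup>T L(r)\<^sup>T\<close>. The growth of \<open>\<Phi>\<close> and of \<open>L\<close> is absorbed by the decay of \<open>B\<close>, so on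
  \<open>[t, t + \<sigma>]\<close> the kernel is bounded by a constant depending only on \<open>\<sigma>\<close>, and the two quadratic
  forms are comparable uniformly in \<open>t\<close>. Since \<open>\<beta> > \<epsilon> + \<ell>\<close>, Gronwall's inequality shows that the
  closed-loop system has nonuniform bounded growth with the same \<open>a\<close> and \<open>\<epsilon>\<close>, so the situation is
  symmetric in \<open>A\<close> and \<open>A - BL\<close>; and bounded growth together with the decay of \<open>B\<close> gives
  all bounds in the definition of controllability from the lower bound on \<open>W\<close>.\<close>

section \<open>Bounded bilinearity of the matrix products\<close>

lemma bounded_bilinear_matrix_matrix_mult:
  "bounded_bilinear ((**) :: real^'k^'m \<Rightarrow> real^'l^'k \<Rightarrow> real^'l^'m)"
  by (subst bilinear_conv_bounded_bilinear[symmetric])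
     (auto simp: bilinear_def matrix_matrix_mult_def vec_eq_iff sum.distrib sum_distrib_left algebra_simps
        intro!: linearI)

lemma bounded_bilinear_matrix_vector_mult:
  "bounded_bilinear ((*v) :: real^'k^'m \<Rightarrow> real^'k \<Rightarrow> real^'m)"
  by (subst bilinear_conv_bounded_bilinear[symmetric])
     (auto simp: bilinear_def matrix_vector_right_distrib matrix_vector_mult_add_rdistrib
        scaleR_matrix_vector_assoc[symmetric] matrix_vector_mult_scaleR intro!: linearI)

lemma bounded_linear_transpose: "bounded_linear (transpose :: real^'k^'m \<Rightarrow> real^'m^'k)"
  by (subst linear_conv_bounded_linear[symmetric]) (auto simp: transpose_def vec_eq_iff intro!: linearI)

text \<open>Row-vector products stand in for transposed transition matrices, both in the quadratic
  forms of the Gramians and in estimates on the second argument of \<Phi>.\<close>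

lemma bounded_bilinear_vector_matrix_mult:
  "bounded_bilinear ((v*) :: real^'m \<Rightarrow> real^'k^'m \<Rightarrow> real^'k)"
  using bounded_bilinear.flip[OF bounded_bilinear.comp[OF bounded_bilinear_matrix_vector_mult
      bounded_linear_transpose bounded_linear_ident]]
  by (simp add: transpose_matrix_vector)

subsection \<open>Antiderivatives of bounded measurable functions\<close>

text \<open>Unlike integrability, this property passes to products, and it still yields
  integrability on compact intervals. The codomain is general so that matrices, vectors and scalars
  are covered at once.\<close>

definition measurable_locally_bounded :: "(real \<Rightarrow> 'a::euclidean_space) \<Rightarrow> bool" where
  "measurable_locally_bounded f \<longleftrightarrow>
     f \<in> borel_measurable (lebesgue_on {0..}) \<and> (\<forall>T\<ge>0. bounded (f ` {0..T}))"

lemma measurable_locally_bounded_continuous: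
  "continuous_on {0..} f \<Longrightarrow> measurable_locally_bounded f"
  unfolding measurable_locally_bounded_def
  by (auto intro!: continuous_imp_measurable_on_sets_lebesgue compact_imp_bounded compact_continuous_image
      elim: continuous_on_subset)

lemma measurable_locally_bounded_bound:
  assumes "measurable_locally_bounded f"
  obtains C where "C > 0" "\<And>r. 0 \<le> r \<Longrightarrow> r \<le> T \<Longrightarrow> norm (f r) \<le> C"
proof (cases "T \<ge> 0")
  case True
  then have "bounded (f ` {0..T})"
    using assms by (auto simp: measurable_locally_bounded_def)
  then show ?thesis using that by (auto simp: bounded_pos)
qed (use that[of 1] in auto)

lemma measurable_locally_bounded_linear:
  assumes "bounded_linear h" "measurable_locally_bounded f"
  shows "measurable_locally_bounded (\<lambda>t. h (f t))"
  unfolding measurable_locally_bounded_def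
proof safe
  have "h \<in> borel_measurable borel"
    using assms(1) by (intro borel_measurable_continuous_onI linear_continuous_on)
  then show "(\<lambda>t. h (f t)) \<in> borel_measurable (lebesgue_on {0..})"
    using assms(2) by (auto simp: measurable_locally_bounded_def intro: measurable_compose)
  fix T :: real assume "T \<ge> 0"
  then have "bounded (h ` f ` {0..T})"
    using assms by (intro bounded_linear_image[OF _ assms(1)]) (auto simp: measurable_locally_bounded_def)
  then show "bounded ((\<lambda>t. h (f t)) ` {0..T})" by (simp add: image_image)
qed

lemma measurable_locally_bounded_bilinear:
  assumes "bounded_bilinear h" "measurable_locally_bounded f" "measurable_locally_bounded g"
  shows "measurable_locally_bounded (\<lambda>t. h (f t) (g t))"
  unfolding measurable_locally_bounded_def
proof safe
  interpret bounded_bilinear h by fact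
  have "continuous_on UNIV (\<lambda>x. h (fst x) (snd x))"
    by (intro continuous_on continuous_on_fst continuous_on_snd continuous_on_id)
  then show "(\<lambda>t. h (f t) (g t)) \<in> borel_measurable (lebesgue_on {0..})"
    using assms(2,3) by (intro borel_measurable_continuous_Pair[where H = h])
      (simp_all add: measurable_locally_bounded_def)
  fix T :: real assume "T \<ge> 0"
  obtain C where C: "C > 0" "\<And>r. 0 \<le> r \<Longrightarrow> r \<le> T \<Longrightarrow> norm (f r) \<le> C"
    using measurable_locally_bounded_bound[OF assms(2)] by metis
  obtain D where D: "D > 0" "\<And>r. 0 \<le> r \<Longrightarrow> r \<le> T \<Longrightarrow> norm (g r) \<le> D"
    using measurable_locally_bounded_bound[OF assms(3)] by metis
  obtain K where K: "K > 0" "\<And>a b. norm (h a b) \<le> norm a * norm b * K"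
    using pos_bounded by auto
  have "norm (h (f r) (g r)) \<le> C * D * K" if "0 \<le> r" "r \<le> T" for r
    by (rule order_trans[OF K(2)]) (use C D K that in \<open>intro mult_right_mono mult_mono, auto\<close>)
  then show "bounded ((\<lambda>t. h (f t) (g t)) ` {0..T})"
    by (auto simp: bounded_iff intro!: exI[of _ "C * D * K"])
qed

lemma measurable_locally_bounded_add:
  "measurable_locally_bounded f \<Longrightarrow> measurable_locally_bounded g \<Longrightarrow>
   measurable_locally_bounded (\<lambda>t. f t + g t)"
  unfolding measurable_locally_bounded_def by (auto intro!: bounded_plus_comp)

lemma measurable_locally_bounded_integrable:
  assumes "measurable_locally_bounded f" "0 \<le> s"
  shows "f integrable_on {s..t}"
proof -
  obtain C where C: "C > 0" "\<And>r. 0 \<le> r \<Longrightarrow> r \<le> t \<Longrightarrow> norm (f r) \<le> C"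
    using measurable_locally_bounded_bound[OF assms(1)] by metis
  have "f \<in> borel_measurable (lebesgue_on {s..t})"
    using assms unfolding measurable_locally_bounded_def
    by (auto intro: measurable_restrict_mono)
  then show ?thesis
    by (rule measurable_bounded_by_integrable_imp_integrable[where g = "\<lambda>_. C"])
       (use C assms in auto)
qed

text \<open>The integral form of F' = f, matching \<open>solves_linear_ode\<close>; as
  \<open>f\<close> is only measurable, a pointwise derivative need not exist everywhere. Local
  boundedness of \<open>f\<close> is built in because it makes \<open>F\<close> locally
  Lipschitz.\<close>

definition antiderivative :: "(real \<Rightarrow> 'a::euclidean_space) \<Rightarrow> (real \<Rightarrow> 'a) \<Rightarrow> bool" where
  "antiderivative F f \<longleftrightarrow> measurable_locally_bounded f \<and>
     (\<forall>s t. 0 \<le> s \<and> s \<le> t \<longrightarrow> (f has_integral (F t - F s)) {s..t})"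

lemma antiderivative_has_integral:
  "antiderivative F f \<Longrightarrow> 0 \<le> s \<Longrightarrow> s \<le> t \<Longrightarrow> (f has_integral (F t - F s)) {s..t}"
  unfolding antiderivative_def by blast

text \<open>Additivity of the integral over adjacent intervals makes the identity based at 0
  sufficient. Integral equations enter the \<open>antiderivative\<close> calculus through this
  lemma.\<close>

lemma antiderivative_integral:
  assumes "measurable_locally_bounded f" and F: "\<And>t. t \<ge> 0 \<Longrightarrow> F t = c + integral {0..t} f"
  shows "antiderivative F f"
  unfolding antiderivative_def
proof safe
  fix s t :: real assume st: "0 \<le> s" "s \<le> t"
  have "integral {0..s} f + integral {s..t} f = integral {0..t} f"
    using st by (intro Henstock_Kurzweil_Integration.integral_combine measurable_locally_bounded_integrable assms(1)) auto
  then have "F t - F s = integral {s..t} f" using F st by (simp add: algebra_simps)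
  then show "(f has_integral (F t - F s)) {s..t}"
    using assms st by (metis integrable_integral measurable_locally_bounded_integrable)
qed fact

text \<open>A bound on \<open>f\<close> over [0,T] is a Lipschitz constant for \<open>F\<close>
  there, so one constant serves both purposes.\<close>

lemma antiderivative_lipschitz:
  assumes "antiderivative F f"
  obtains C where "C > 0" "\<And>r. 0 \<le> r \<Longrightarrow> r \<le> T \<Longrightarrow> norm (f r) \<le> C"
    "\<And>s t. 0 \<le> s \<Longrightarrow> s \<le> t \<Longrightarrow> t \<le> T \<Longrightarrow> norm (F t - F s) \<le> C * (t - s)"
proof -
  obtain C where C: "C > 0" "\<And>r. 0 \<le> r \<Longrightarrow> r \<le> T \<Longrightarrow> norm (f r) \<le> C"
    using measurable_locally_bounded_bound assms by (metis antiderivative_def)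
  have "norm (F t - F s) \<le> C * (t - s)" if "0 \<le> s" "s \<le> t" "t \<le> T" for s t
    using has_integral_bound_real[OF _ _ antiderivative_has_integral[OF assms, of s t], of C "{}"] that C
    by auto
  then show ?thesis using C that by blast
qed

lemma antiderivative_continuous_on:
  assumes "antiderivative F f"
  shows "continuous_on {0..} F"
  unfolding continuous_on_iff
proof safe
  fix x e :: real assume x: "0 \<le> x" "0 < e"
  obtain C where C: "C > 0" 
    "\<And>s t. 0 \<le> s \<Longrightarrow> s \<le> t \<Longrightarrow> t \<le> x + 1 \<Longrightarrow> norm (F t - F s) \<le> C * (t - s)"
    using antiderivative_lipschitz[OF assms] by metis
  have "dist (F y) (F x) < e" if y: "0 \<le> y" "dist y x < min 1 (e / C)" for y
  proof -
    have "dist (F y) (F x) \<le> C * \<bar>y - x\<bar>"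
      using C(2)[of x y] C(2)[of y x] x y by (cases "x \<le> y") (auto simp: dist_norm norm_minus_commute)
    also have "\<dots> < e" using y C by (auto simp: dist_norm field_simps)
    finally show ?thesis .
  qed
  then show "\<exists>d>0. \<forall>y\<in>{0..}. dist y x < d \<longrightarrow> dist (F y) (F x) < e"
    using C x by (intro exI[of _ "min 1 (e / C)"]) auto
qed

text \<open>Difference quotients are at most a constant times the step size, so the derivative
  vanishes everywhere.\<close>

lemma quadratic_increments_imp_constant:
  fixes f :: "real \<Rightarrow> 'a::real_normed_vector"
  assumes f: "\<And>s t. a \<le> s \<Longrightarrow> s \<le> t \<Longrightarrow> t \<le> b \<Longrightarrow> norm (f t - f s) \<le> C * (t - s)\<^sup>2"
    and "a \<le> b"
  shows "f b = f a"
proof -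
  \<comment> \<open>The absolute value of \<open>C\<close> and both orders of the arguments prepare
    for the two-sided derivative.\<close>
  have C: "norm (f y - f x) \<le> \<bar>C\<bar> * (y - x)\<^sup>2" if "x \<in> {a..b}" "y \<in> {a..b}" for x y
  proof -
    have "norm (f y - f x) \<le> C * (y - x)\<^sup>2"
      using f[of x y] f[of y x] that
      by (cases "x \<le> y") (auto simp: norm_minus_commute power2_commute)
    also have "\<dots> \<le> \<bar>C\<bar> * (y - x)\<^sup>2" by (intro mult_right_mono) auto
    finally show ?thesis .
  qed
  have "(f has_vector_derivative 0) (at x within {a..b})" if x: "x \<in> {a..b}" for x
    unfolding has_vector_derivative_def has_derivative_within_alt
  proof (intro conjI allI impI)
    fix e :: real assume e: "0 < e"
    \<comment> \<open>The radius has |C| + 1 in the denominator because \<open>C\<close> may be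
      0.\<close>
    have "norm (f y - f x) \<le> e * norm (y - x)" if y: "y \<in> {a..b}" "norm (y - x) < e / (\<bar>C\<bar> + 1)" for y
    proof -
      have "\<bar>C\<bar> * \<bar>y - x\<bar> \<le> (\<bar>C\<bar> + 1) * \<bar>y - x\<bar>" by (simp add: mult_right_mono)
      also have "\<dots> \<le> e" using y by (simp add: field_simps)
      finally have "\<bar>C\<bar> * \<bar>y - x\<bar> * \<bar>y - x\<bar> \<le> e * \<bar>y - x\<bar>"
        by (intro mult_right_mono) auto
      then show ?thesis using C[OF x y(1)] by (simp add: power2_eq_square mult.assoc)
    qed
    then show "\<exists>d>0. \<forall>y\<in>{a..b}. norm (y - x) < d \<longrightarrow>
        norm (f y - f x - (y - x) *\<^sub>R 0) \<le> e * norm (y - x)"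
      using e by (intro exI[of _ "e / (\<bar>C\<bar> + 1)"]) auto
  qed simp
  then show ?thesis
    using has_vector_derivative_zero_constant[of "{a..b}" f] \<open>a \<le> b\<close>
    by (metis atLeastAtMost_iff convex_real_interval(5) order_refl)
qed

text \<open>The product rule cannot be read off from pointwise derivatives, as the integrands are only
  measurable; instead \<open>h (F t) (G t) - \<integral>\<^sub>0\<^sup>t (h f G + h F g)\<close> has increments that are quadratic in the
  step size.\<close>

lemma antiderivative_bilinear:
  assumes h: "bounded_bilinear h" and F: "antiderivative F f" and G: "antiderivative G g"
  shows "antiderivative (\<lambda>t. h (F t) (G t)) (\<lambda>t. h (f t) (G t) + h (F t) (g t))"
    (is "antiderivative ?H ?e")
proof -
  interpret bounded_bilinear h by fact
  have mf: "measurable_locally_bounded f" and mg: "measurable_locally_bounded g"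
    and mF: "measurable_locally_bounded F" and mG: "measurable_locally_bounded G"
    using F G antiderivative_continuous_on measurable_locally_bounded_continuous
    by (auto simp: antiderivative_def)
  have me: "measurable_locally_bounded ?e"
    by (intro measurable_locally_bounded_add measurable_locally_bounded_bilinear[OF h] mf mg mF mG)
  obtain K where K: "K > 0" "\<And>a b. norm (h a b) \<le> norm a * norm b * K"
    using pos_bounded by auto
  have "?H T - integral {0..T} ?e = ?H 0 - integral {0..0} ?e" if "T \<ge> 0" for T
  proof -
    obtain C where C: "C > 0" "\<And>r. 0 \<le> r \<Longrightarrow> r \<le> T \<Longrightarrow> norm (f r) \<le> C"
      "\<And>s t. 0 \<le> s \<Longrightarrow> s \<le> t \<Longrightarrow> t \<le> T \<Longrightarrow> norm (F t - F s) \<le> C * (t - s)"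
      using antiderivative_lipschitz[OF F] by metis
    obtain D where D: "D > 0" "\<And>r. 0 \<le> r \<Longrightarrow> r \<le> T \<Longrightarrow> norm (g r) \<le> D"
      "\<And>s t. 0 \<le> s \<Longrightarrow> s \<le> t \<Longrightarrow> t \<le> T \<Longrightarrow> norm (G t - G s) \<le> D * (t - s)"
      using antiderivative_lipschitz[OF G] by metis
    show ?thesis
    proof (rule quadratic_increments_imp_constant[where C = "2 * C * D * K", OF _ that])
    fix s t assume st: "0 \<le> s" "s \<le> t" "t \<le> T"
    have comb: "integral {0..s} ?e + integral {s..t} ?e = integral {0..t} ?e"
      using st by (intro Henstock_Kurzweil_Integration.integral_combine measurable_locally_bounded_integrable me) auto
    \<comment> \<open>Freeze \<open>G\<close> at the right endpoint and \<open>F\<close> at the left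
      one: the two integrals then add up exactly to the increment of h (F) (G).\<close>
    have "((\<lambda>r. h (f r) (G t)) has_integral h (F t - F s) (G t)) {s..t}"
      using has_integral_linear[OF antiderivative_has_integral[OF F st(1,2)] bounded_linear_left]
      by (simp add: o_def)
    moreover have "((\<lambda>r. h (F s) (g r)) has_integral h (F s) (G t - G s)) {s..t}"
      using has_integral_linear[OF antiderivative_has_integral[OF G st(1,2)] bounded_linear_right]
      by (simp add: o_def)
    moreover have "(?e has_integral integral {s..t} ?e) {s..t}"
      using st by (intro integrable_integral measurable_locally_bounded_integrable me) auto
    ultimately have "((\<lambda>r. h (f r) (G t) + h (F s) (g r) - ?e r) has_integral
        h (F t - F s) (G t) + h (F s) (G t - G s) - integral {s..t} ?e) {s..t}"
      by (intro has_integral_diff has_integral_add)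
    note int = this
    \<comment> \<open>Freezing costs h (f r) (G t - G r) in one term and h (F r - F s) (g r) in the
      other; by the Lipschitz bounds each is at most C D K (t - s).\<close>
    have bound: "norm (h (f r) (G t) + h (F s) (g r) - ?e r) \<le> 2 * C * D * K * (t - s)"
      if r: "s \<le> r" "r \<le> t" for r
    proof -
      have "norm (h (f r) (G t) + h (F s) (g r) - ?e r)
          = norm (h (f r) (G t - G r) - h (F r - F s) (g r))"
        by (simp add: diff_left diff_right algebra_simps)
      also have "\<dots> \<le> norm (h (f r) (G t - G r)) + norm (h (F r - F s) (g r))"
        by (rule norm_triangle_ineq4)
      also have "\<dots> \<le> C * (D * (t - s)) * K + (C * (t - s)) * D * K"
      proof (intro add_mono order_trans[OF K(2)] mult_right_mono mult_mono)
        show "norm (G t - G r) \<le> D * (t - s)"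
          using D(3)[of r t] D(1) r st
          by (meson diff_left_mono dual_order.trans mult_left_mono order_less_imp_le)
        show "norm (F r - F s) \<le> C * (t - s)"
          using C(3)[of s r] C(1) r st
          by (meson diff_right_mono dual_order.trans mult_left_mono order_less_imp_le)
      qed (use C D K r st in auto)
      also have "\<dots> = 2 * C * D * K * (t - s)" by simp
      finally show ?thesis .
    qed
    have "norm (h (F t - F s) (G t) + h (F s) (G t - G s) - integral {s..t} ?e)
        \<le> (2 * C * D * K * (t - s)) * (t - s)"
      using has_integral_bound_real[OF _ _ int, of "2 * C * D * K * (t - s)" "{}"] bound C D K st by auto
    moreover have "?H t - integral {0..t} ?e - (?H s - integral {0..s} ?e)
        = h (F t - F s) (G t) + h (F s) (G t - G s) - integral {s..t} ?e"
      unfolding comb[symmetric] by (simp add: diff_left diff_right algebra_simps)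
    ultimately show "norm (?H t - integral {0..t} ?e - (?H s - integral {0..s} ?e))
        \<le> (2 * C * D * K) * (t - s)\<^sup>2"
      using st by (simp add: power2_eq_square mult.assoc)
    qed
  qed
  note const = this
  show ?thesis
  proof (rule antiderivative_integral[OF me])
    fix t :: real assume "t \<ge> 0"
    from const[OF this] show "?H t = ?H 0 + integral {0..t} ?e"
      by (simp add: diff_eq_eq)
  qed
qed

subsection \<open>Transition matrices\<close>

text \<open>Peano-Baker series: on a compact interval its k-th term is at most N (C t)^k / k!, so it
  converges by comparison with the exponential series, and dominated convergence carries the limit
  through the integral equation.\<close>

lemma linear_ode_matrix_solution_exists:
  fixes A :: "real \<Rightarrow> real^'n^'n"
  assumes A: "measurable_locally_bounded A"
  obtains X :: "real \<Rightarrow> real^'n^'n" where "antiderivative X (\<lambda>r. A r ** X r)" "X 0 = mat 1"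
proof -
  interpret m: bounded_bilinear "(**) :: real^'n^'n \<Rightarrow> real^'n^'n \<Rightarrow> real^'n^'n"
    by (rule bounded_bilinear_matrix_matrix_mult)
  \<comment> \<open>the Picard iterates; \<open>X\<close> is the sum of the series\<close>
  define P :: "nat \<Rightarrow> real \<Rightarrow> real^'n^'n"
    where "P = rec_nat (\<lambda>t. mat 1) (\<lambda>k p t. integral {0..t} (\<lambda>r. A r ** p r))"
  have P0: "P 0 t = mat 1" and PS: "P (Suc k) t = integral {0..t} (\<lambda>r. A r ** P k r)" for k t
    by (simp_all add: P_def)
  have mAP: "measurable_locally_bounded (\<lambda>r. A r ** P k r)"
    if "measurable_locally_bounded (P k)" for k
    by (rule measurable_locally_bounded_bilinear[OF bounded_bilinear_matrix_matrix_mult A that])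
  have mP: "measurable_locally_bounded (P k)" for k
  proof (induction k)
    case 0
    show ?case by (intro measurable_locally_bounded_continuous) (simp add: P0)
  next
    case (Suc k)
    have "antiderivative (P (Suc k)) (\<lambda>r. A r ** P k r)"
      by (rule antiderivative_integral[OF mAP[OF Suc], of _ 0]) (simp add: PS)
    then show ?case
      by (intro measurable_locally_bounded_continuous antiderivative_continuous_on)
  qed
  define X where "X = (\<lambda>t. \<Sum>k. P k t)"
  define N where "N = norm (mat 1 :: real^'n^'n)"
  obtain K where K: "K > 0" "\<And>(a :: real^'n^'n) (b :: real^'n^'n). norm (a ** b) \<le> norm a * norm b * K"
    using m.pos_bounded by auto
  \<comment> \<open>A single \<open>C\<close>, depending on \<open>T\<close> only, is wanted for
    both estimates: it is the bound of \<open>A\<close> on [0,T] times the constant \<open>K\<close>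
    of matrix multiplication.\<close>
  have bound: "\<exists>C>0. (\<forall>k. \<forall>t\<in>{0..T}. norm (P k t) \<le> N * ((C * t) ^ k / fact k)) \<and>
      (\<forall>t\<in>{0..T}. \<forall>x :: real^'n^'n. norm (A t ** x) \<le> C * norm x)" for T
  proof -
    obtain C where C: "C > 0" "\<And>r. 0 \<le> r \<Longrightarrow> r \<le> T \<Longrightarrow> norm (A r) \<le> C"
      using measurable_locally_bounded_bound[OF A] by metis
    have CA: "norm (A t ** x) \<le> (C * K) * norm x" if "t \<in> {0..T}" for t and x :: "real^'n^'n"
    proof -
      have "norm (A t ** x) \<le> norm (A t) * norm x * K" by (rule K)
      also have "\<dots> \<le> C * norm x * K" using C K that by (intro mult_right_mono) auto
      finally show ?thesis by (simp add: mult_ac)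
    qed
    have "\<forall>t\<in>{0..T}. norm (P k t) \<le> N * ((C * K * t) ^ k / fact k)" for k
    proof (induction k)
      case 0
      show ?case by (simp add: P0 N_def)
    next
      case (Suc k)
      show ?case
      proof
        fix t assume t: "t \<in> {0..T}"
        have nz: "1 + real k \<noteq> 0" by linarith
        \<comment> \<open>Each bound in the sequence is an antiderivative of C K times the preceding
          one; this drives the induction.\<close>
        have deriv: "((\<lambda>r. N * ((C * K * r) ^ Suc k / fact (Suc k))) has_vector_derivative
            (C * K) * (N * ((C * K * r) ^ k / fact k))) (at r within {0..t})" for r
          unfolding has_real_derivative_iff_has_vector_derivative[symmetric]
          by (rule DERIV_cong[OF DERIV_cmult[OF DERIV_cdivide[OF DERIV_power_Suc[OF DERIV_cmult_Id]]]])
             (simp add: nz divide_simps)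
        have int: "((\<lambda>r. (C * K) * (N * ((C * K * r) ^ k / fact k))) has_integral
            N * ((C * K * t) ^ Suc k / fact (Suc k))) {0..t}"
          using fundamental_theorem_of_calculus[OF _ deriv] t by simp
        have "norm (P (Suc k) t) \<le> integral {0..t} (\<lambda>r. (C * K) * (N * ((C * K * r) ^ k / fact k)))"
          unfolding PS
        proof (rule Henstock_Kurzweil_Integration.integral_norm_bound_integral)
          show "(\<lambda>r. A r ** P k r) integrable_on {0..t}"
            by (intro measurable_locally_bounded_integrable mAP mP) auto
          fix r assume "r \<in> {0..t}"
          then have r: "r \<in> {0..T}" using t by auto
          have "norm (A r ** P k r) \<le> (C * K) * norm (P k r)" by (rule CA[OF r])
          also have "\<dots> \<le> (C * K) * (N * ((C * K * r) ^ k / fact k))"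
            using Suc r C K by (intro mult_left_mono) auto
          finally show "norm (A r ** P k r) \<le> (C * K) * (N * ((C * K * r) ^ k / fact k))" .
        qed (use int in blast)
        then show "norm (P (Suc k) t) \<le> N * ((C * K * t) ^ Suc k / fact (Suc k))"
          unfolding integral_unique[OF int] .
      qed
    qed
    then show ?thesis using CA C K by (intro exI[of _ "C * K"]) auto
  qed
  have exp_series: "summable (\<lambda>k. N * (x ^ k / fact k))" "(\<Sum>k. N * (x ^ k / fact k)) = N * exp x"
    for x :: real
    using sums_mult[OF exp_converges[of x], of N]
    by (auto simp: sums_iff divide_inverse mult_ac)
  \<comment> \<open>Uniform in \<open>n\<close> and \<open>r\<close>: this gives the local
    boundedness of \<open>X\<close> and later the integrable majorant.\<close>
  have partial: "norm (\<Sum>k<n. P k r) \<le> N * exp (C * T)"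
    if "\<forall>k. \<forall>t\<in>{0..T}. norm (P k t) \<le> N * ((C * t) ^ k / fact k)" "C > 0" "r \<in> {0..T}" for n C T r
  proof -
    have "norm (\<Sum>k<n. P k r) \<le> (\<Sum>k<n. N * ((C * r) ^ k / fact k))"
      using that by (intro sum_norm_le) auto
    also have "\<dots> \<le> N * exp (C * r)"
      unfolding exp_series(2)[symmetric]
      using that by (intro sum_le_suminf exp_series) (auto simp: N_def)
    also have "\<dots> \<le> N * exp (C * T)"
      using that by (intro mult_left_mono) (auto simp: N_def)
    finally show ?thesis .
  qed
  have sm: "summable (\<lambda>k. P k t)" if "t \<ge> 0" for t
  proof -
    obtain C where C: "C > 0" "\<forall>k. \<forall>s\<in>{0..t}. norm (P k s) \<le> N * ((C * s) ^ k / fact k)"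
      using bound[of t] by blast
    then show ?thesis
      using that by (intro summable_comparison_test'[OF exp_series(1)[of "C * t"], of 0]) auto
  qed
  have lim: "(\<lambda>n. \<Sum>k<n. P k t) \<longlonglongrightarrow> X t" if "t \<ge> 0" for t
    using summable_LIMSEQ[OF sm[OF that]] by (simp add: X_def)
  have mX: "measurable_locally_bounded X"
    unfolding measurable_locally_bounded_def
  proof safe
    show "X \<in> borel_measurable (lebesgue_on {0..})"
    proof (rule borel_measurable_LIMSEQ_metric)
      show "(\<lambda>t. \<Sum>k<n. P k t) \<in> borel_measurable (lebesgue_on {0..})" for n
        using mP by (intro borel_measurable_sum) (auto simp: measurable_locally_bounded_def)
    qed (use lim in auto)
    fix T :: real assume "T \<ge> 0"
    obtain C where C: "C > 0" "\<forall>k. \<forall>s\<in>{0..T}. norm (P k s) \<le> N * ((C * s) ^ k / fact k)"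
      using bound[of T] by blast
    have "norm (X t) \<le> N * exp (C * T)" if "t \<in> {0..T}" for t
      using that partial[OF C(2,1) that] by (intro LIMSEQ_le_const2[OF tendsto_norm[OF lim]]) auto
    then show "bounded (X ` {0..T})" by (auto simp: bounded_iff intro!: exI[of _ "N * exp (C * T)"])
  qed
  have mAX: "measurable_locally_bounded (\<lambda>r. A r ** X r)"
    by (rule measurable_locally_bounded_bilinear[OF bounded_bilinear_matrix_matrix_mult A mX])
  have "X t = mat 1 + integral {0..t} (\<lambda>r. A r ** X r)" if "t \<ge> 0" for t
  proof -
    obtain C where C: "C > 0" "\<forall>k. \<forall>s\<in>{0..t}. norm (P k s) \<le> N * ((C * s) ^ k / fact k)"
      "\<forall>s\<in>{0..t}. \<forall>x :: real^'n^'n. norm (A s ** x) \<le> C * norm x"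
      using bound[of t] by blast
    \<comment> \<open>Multiplying a partial sum by \<open>A\<close> and integrating shifts the index
      by one.\<close>
    have int: "((\<lambda>r. A r ** (\<Sum>k<n. P k r)) has_integral (\<Sum>k<n. P (Suc k) t)) {0..t}" for n
      unfolding m.sum_right
      by (intro has_integral_sum) (auto simp: PS intro!: integrable_integral measurable_locally_bounded_integrable mAP mP)
    have "(\<lambda>n. integral {0..t} (\<lambda>r. A r ** (\<Sum>k<n. P k r))) \<longlonglongrightarrow> integral {0..t} (\<lambda>r. A r ** X r)"
    proof (rule dominated_convergence(2)[where h = "\<lambda>_. C * (N * exp (C * t))"])
      show "(\<lambda>r. A r ** (\<Sum>k<n. P k r)) integrable_on {0..t}" for n
        using int by blast
      show "norm (A r ** (\<Sum>k<n. P k r)) \<le> C * (N * exp (C * t))" if "r \<in> {0..t}" for n r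
        using C partial[OF C(2,1) that, of n] that
        by (meson dual_order.trans mult_left_mono order_less_imp_le)
      show "(\<lambda>n. A r ** (\<Sum>k<n. P k r)) \<longlonglongrightarrow> A r ** X r" if "r \<in> {0..t}" for r
        using that by (intro m.tendsto tendsto_const lim) auto
    qed auto
    then have "(\<lambda>n. \<Sum>k<n. P (Suc k) t) \<longlonglongrightarrow> integral {0..t} (\<lambda>r. A r ** X r)"
      unfolding integral_unique[OF int] .
    \<comment> \<open>The shifted series lacks only the term of index 0, which is the
      identity.\<close>
    moreover have "(\<lambda>n. \<Sum>k<n. P (Suc k) t) \<longlonglongrightarrow> X t - mat 1"
      using sums_Suc_iff[where f = "\<lambda>k. P k t" and s = "X t - mat 1"] lim[OF that] by (simp add: sums_def P0)
    ultimately show ?thesis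
      using LIMSEQ_unique by fastforce
  qed
  then have "antiderivative X (\<lambda>r. A r ** X r)"
    by (intro antiderivative_integral[OF mAX]) auto
  moreover have "X 0 = mat 1"
    using \<open>\<And>t. t \<ge> 0 \<Longrightarrow> X t = mat 1 + integral {0..t} (\<lambda>r. A r ** X r)\<close>[of 0] by simp
  ultimately show ?thesis using that by blast
qed

lemma antiderivative_linear:
  assumes "bounded_linear h" "antiderivative F f"
  shows "antiderivative (\<lambda>t. h (F t)) (\<lambda>t. h (f t))"
  unfolding antiderivative_def
proof safe
  interpret bounded_linear h by fact
  show "measurable_locally_bounded (\<lambda>t. h (f t))"
    using assms by (auto simp: antiderivative_def intro: measurable_locally_bounded_linear)
  fix s t :: real assume "0 \<le> s" "s \<le> t"
  then show "((\<lambda>t. h (f t)) has_integral h (F t) - h (F s)) {s..t}"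
    using has_integral_linear[OF antiderivative_has_integral[OF assms(2)] assms(1), of s t]
    by (simp add: o_def diff)
qed

text \<open>The tool for conserved quantities: the product rule produces an integrand whose terms
  cancel, so the product of two solutions stays constant.\<close>

lemma antiderivative_zero:
  assumes "antiderivative F f" "\<And>r. r \<ge> 0 \<Longrightarrow> f r = 0" "t \<ge> 0" "s \<ge> 0"
  shows "F t = F s"
proof -
  have "F t = F 0" if "t \<ge> 0" for t
  proof -
    have "((\<lambda>_. 0) has_integral (F t - F 0)) {0..t}"
      by (rule has_integral_eq[OF _ antiderivative_has_integral[OF assms(1)]]) (use assms(2) that in auto)
    then show ?thesis using has_integral_unique[OF has_integral_0] by fastforce
  qed
  then show ?thesis using assms by metis
qed

text \<open>The product rule gives (Y X)' = - Y A X + Y A X = 0, so Y X keeps its initial value, the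
  identity; for square matrices a left inverse is also a right inverse. Having an equation for the
  inverse makes X(t) Y(s) accessible to the product rule in both variables.\<close>

lemma fundamental_matrices_exist:
  fixes A :: "real \<Rightarrow> real^'n^'n"
  assumes A: "measurable_locally_bounded A"
  obtains X Y :: "real \<Rightarrow> real^'n^'n" where "antiderivative X (\<lambda>r. A r ** X r)" "antiderivative Y (\<lambda>r. - (Y r ** A r))"
    "\<And>t. t \<ge> 0 \<Longrightarrow> Y t ** X t = mat 1" "\<And>t. t \<ge> 0 \<Longrightarrow> X t ** Y t = mat 1"
proof -
  obtain X where X: "antiderivative X (\<lambda>r. A r ** X r)" "X 0 = mat 1"
    using linear_ode_matrix_solution_exists[OF A] .
  have "bounded_linear (\<lambda>M :: real^'n^'n. - transpose M)"
    by (intro bounded_linear_minus bounded_linear_transpose)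
  then have "measurable_locally_bounded (\<lambda>t. - transpose (A t))"
    by (rule measurable_locally_bounded_linear[OF _ A])
  from linear_ode_matrix_solution_exists[OF this]
  obtain Z where Z: "antiderivative Z (\<lambda>r. - transpose (A r) ** Z r)" "Z 0 = mat 1" .
  \<comment> \<open>the adjoint equation yields the inverse of \<open>X\<close>\<close>
  define Y where "Y = (\<lambda>t. transpose (Z t))"
  interpret m: bounded_bilinear "(**) :: real^'n^'n \<Rightarrow> real^'n^'n \<Rightarrow> real^'n^'n"
    by (rule bounded_bilinear_matrix_matrix_mult)
  interpret tr: bounded_linear "transpose :: real^'n^'n \<Rightarrow> real^'n^'n"
    by (rule bounded_linear_transpose)
  have Y: "antiderivative Y (\<lambda>r. - (Y r ** A r))"
    using antiderivative_linear[OF bounded_linear_transpose Z(1)]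
    by (simp add: Y_def matrix_transpose_mul tr.neg m.minus_right)
  have "antiderivative (\<lambda>t. Y t ** X t) (\<lambda>t. - (Y t ** A t) ** X t + Y t ** (A t ** X t))"
    by (rule antiderivative_bilinear[OF bounded_bilinear_matrix_matrix_mult Y X(1)])
  then have "Y t ** X t = Y 0 ** X 0" if "t \<ge> 0" for t
    by (rule antiderivative_zero) (use that in \<open>auto simp: m.minus_left matrix_mul_assoc\<close>)
  then have YX: "Y t ** X t = mat 1" if "t \<ge> 0" for t
    using that X Z by (simp add: Y_def)
  then have "X t ** Y t = mat 1" if "t \<ge> 0" for t
    using that matrix_left_right_inverse by blast
  with X Y YX show ?thesis using that by blast
qed

lemma solves_linear_ode_iff_antiderivative:
  assumes "measurable_locally_bounded A"
  shows "solves_linear_ode A x \<longleftrightarrow> antiderivative x (\<lambda>r. A r *v x r)"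
proof
  assume x: "solves_linear_ode A x"
  then have "measurable_locally_bounded (\<lambda>r. A r *v x r)"
    by (intro measurable_locally_bounded_bilinear[OF bounded_bilinear_matrix_vector_mult assms]
        measurable_locally_bounded_continuous) (simp add: solves_linear_ode_def)
  with x show "antiderivative x (\<lambda>r. A r *v x r)"
    by (auto simp: antiderivative_def solves_linear_ode_def)
qed (auto simp: solves_linear_ode_def antiderivative_has_integral antiderivative_continuous_on)

text \<open>Along a solution x the vector Y x is conserved, which shows that X(t) Y(s) has the
  defining property. Uniqueness, needed for the definite description, holds because solutions take
  arbitrary values at time s.\<close>

lemma transition_matrix_eq:
  fixes A X Y :: "real \<Rightarrow> real^'n^'n"
  assumes A: "measurable_locally_bounded A"
    and X: "antiderivative X (\<lambda>r. A r ** X r)" and Y: "antiderivative Y (\<lambda>r. - (Y r ** A r))"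
    and YX: "\<And>t. t \<ge> 0 \<Longrightarrow> Y t ** X t = mat 1" and XY: "\<And>t. t \<ge> 0 \<Longrightarrow> X t ** Y t = mat 1"
    and "t \<ge> 0" "s \<ge> 0"
  shows "transition_matrix A t s = X t ** Y s"
  unfolding transition_matrix_def
proof (rule the_equality)
  interpret m: bounded_bilinear "(*v) :: real^'n^'n \<Rightarrow> real^'n \<Rightarrow> real^'n"
    by (rule bounded_bilinear_matrix_vector_mult)
  have neg: "- M *v y = - (M *v y)" for M :: "real^'n^'n" and y
    by (rule m.minus_left)
  show "\<forall>x. solves_linear_ode A x \<longrightarrow> x t = (X t ** Y s) *v x s"
  proof safe
    fix x assume "solves_linear_ode A x"
    then have x: "antiderivative x (\<lambda>r. A r *v x r)"
      by (simp add: solves_linear_ode_iff_antiderivative[OF A])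
    have "antiderivative (\<lambda>t. Y t *v x t) (\<lambda>t. - (Y t ** A t) *v x t + Y t *v (A t *v x t))"
      by (rule antiderivative_bilinear[OF bounded_bilinear_matrix_vector_mult Y x])
    then have "Y t *v x t = Y s *v x s"
    proof (rule antiderivative_zero)
      show "- (Y r ** A r) *v x r + Y r *v (A r *v x r) = 0" for r
        unfolding neg matrix_vector_mul_assoc by simp
    qed fact+
    then have "X t *v (Y t *v x t) = X t *v (Y s *v x s)" by simp
    then show "x t = (X t ** Y s) *v x s"
      using XY \<open>t \<ge> 0\<close> by (simp add: matrix_vector_mul_assoc)
  qed
  fix M assume M: "\<forall>x. solves_linear_ode A x \<longrightarrow> x t = M *v x s"
  \<comment> \<open>The curve t \<mapsto> X(t) Y(s) v is the solution with value v at time s;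
    evaluating the property of \<open>M\<close> on it determines \<open>M\<close> on v.\<close>
  have "M *v v = (X t ** Y s) *v v" for v
  proof -
    have "antiderivative (\<lambda>t. X t *v (Y s *v v)) (\<lambda>t. (A t ** X t) *v (Y s *v v))"
      by (rule antiderivative_linear[OF m.bounded_linear_left X])
    then have "solves_linear_ode A (\<lambda>t. X t *v (Y s *v v))"
      by (simp add: solves_linear_ode_iff_antiderivative[OF A] matrix_vector_mul_assoc matrix_mul_assoc)
    from M[rule_format, OF this] show ?thesis
      using XY \<open>s \<ge> 0\<close> by (simp add: matrix_vector_mul_assoc)
  qed
  then show "M = X t ** Y s" by (simp add: matrix_eq)
qed

lemma transition_matrix_self:
  fixes A :: "real \<Rightarrow> real^'n^'n"
  assumes "measurable_locally_bounded A" "t \<ge> 0"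
  shows "transition_matrix A t t = mat 1"
proof -
  obtain X Y :: "real \<Rightarrow> real^'n^'n" where XY: "antiderivative X (\<lambda>r. A r ** X r)" "antiderivative Y (\<lambda>r. - (Y r ** A r))"
    "\<And>t. t \<ge> 0 \<Longrightarrow> Y t ** X t = mat 1" "\<And>t. t \<ge> 0 \<Longrightarrow> X t ** Y t = mat 1"
    using fundamental_matrices_exist[OF assms(1)] by blast
  show ?thesis
    using transition_matrix_eq[OF assms(1) XY assms(2,2)] XY(4)[OF assms(2)] by simp
qed

lemma transition_matrix_compose:
  fixes A :: "real \<Rightarrow> real^'n^'n"
  assumes A: "measurable_locally_bounded A" and "t \<ge> 0" "s \<ge> 0" "r \<ge> 0"
  shows "transition_matrix A t s ** transition_matrix A s r = transition_matrix A t r"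
proof -
  obtain X Y :: "real \<Rightarrow> real^'n^'n" where XY: "antiderivative X (\<lambda>r. A r ** X r)" "antiderivative Y (\<lambda>r. - (Y r ** A r))"
    "\<And>t. t \<ge> 0 \<Longrightarrow> Y t ** X t = mat 1" "\<And>t. t \<ge> 0 \<Longrightarrow> X t ** Y t = mat 1"
    using fundamental_matrices_exist[OF A] by blast
  have "transition_matrix A t s ** transition_matrix A s r = X t ** (Y s ** X s) ** Y r"
    using transition_matrix_eq[OF A XY] assms by (simp add: matrix_mul_assoc)
  then show ?thesis
    using transition_matrix_eq[OF A XY] XY assms by simp
qed

lemma transition_matrix_continuous_on:
  fixes A :: "real \<Rightarrow> real^'n^'n"
  assumes A: "measurable_locally_bounded A" and "s \<ge> 0"
  shows "continuous_on {0..} (\<lambda>t. transition_matrix A t s)"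
    and "continuous_on {0..} (\<lambda>t. transition_matrix A s t)"
proof -
  obtain X Y :: "real \<Rightarrow> real^'n^'n" where XY: "antiderivative X (\<lambda>r. A r ** X r)" "antiderivative Y (\<lambda>r. - (Y r ** A r))"
    "\<And>t. t \<ge> 0 \<Longrightarrow> Y t ** X t = mat 1" "\<And>t. t \<ge> 0 \<Longrightarrow> X t ** Y t = mat 1"
    using fundamental_matrices_exist[OF A] by blast
  note eq = transition_matrix_eq[OF A XY]
  note cont = bounded_bilinear.continuous_on[OF bounded_bilinear_matrix_matrix_mult]
  have "continuous_on {0..} (\<lambda>t. X t ** Y s)" "continuous_on {0..} (\<lambda>t. X s ** Y t)"
    by (intro cont continuous_on_const antiderivative_continuous_on[OF XY(1)]
        antiderivative_continuous_on[OF XY(2)])+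
  then show "continuous_on {0..} (\<lambda>t. transition_matrix A t s)"
    "continuous_on {0..} (\<lambda>t. transition_matrix A s t)"
    using \<open>s \<ge> 0\<close> by (simp_all add: eq cong: continuous_on_cong_simp)
qed

text \<open>Variation of constants: the derivative of r \<mapsto> \<Phi>'(t,r) \<Phi>(r,s) is
  \<Phi>'(t,r) (A(r) - A'(r)) \<Phi>(r,s). Since \<open>t\<close> and \<open>s\<close> are unrelated
  to \<open>u\<close> and \<open>v\<close>, the formula serves forward and backward in time, and the
  two systems may be exchanged.\<close>

lemma transition_matrix_perturbation:
  fixes A A' :: "real \<Rightarrow> real^'n^'n"
  assumes A: "measurable_locally_bounded A" and A': "measurable_locally_bounded A'"
    and nonneg: "t \<ge> 0" "s \<ge> 0" "u \<ge> 0" and "u \<le> v"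
  shows "((\<lambda>r. transition_matrix A' t r ** (A r - A' r) ** transition_matrix A r s) has_integral
      (transition_matrix A' t v ** transition_matrix A v s
        - transition_matrix A' t u ** transition_matrix A u s)) {u..v}"
proof -
  interpret m: bounded_bilinear "(**) :: real^'n^'n \<Rightarrow> real^'n^'n \<Rightarrow> real^'n^'n"
    by (rule bounded_bilinear_matrix_matrix_mult)
  obtain X Y :: "real \<Rightarrow> real^'n^'n" where XY: "antiderivative X (\<lambda>r. A r ** X r)" "antiderivative Y (\<lambda>r. - (Y r ** A r))"
    "\<And>t. t \<ge> 0 \<Longrightarrow> Y t ** X t = mat 1" "\<And>t. t \<ge> 0 \<Longrightarrow> X t ** Y t = mat 1"
    using fundamental_matrices_exist[OF A] by blast
  obtain X' Y' :: "real \<Rightarrow> real^'n^'n" where XY': "antiderivative X' (\<lambda>r. A' r ** X' r)" "antiderivative Y' (\<lambda>r. - (Y' r ** A' r))"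
    "\<And>t. t \<ge> 0 \<Longrightarrow> Y' t ** X' t = mat 1" "\<And>t. t \<ge> 0 \<Longrightarrow> X' t ** Y' t = mat 1"
    using fundamental_matrices_exist[OF A'] by blast
  note eqs = transition_matrix_eq[OF A XY] transition_matrix_eq[OF A' XY']
  have lin: "bounded_linear (\<lambda>M. X' t ** M ** Y s)"
    by (intro bounded_linear_compose[OF m.bounded_linear_left] m.bounded_linear_right)
  \<comment> \<open>The product rule is applied to Y' X alone; X'(t) and Y(s) are constant outer
    factors.\<close>
  have "((\<lambda>r. X' t ** (- (Y' r ** A' r) ** X r + Y' r ** (A r ** X r)) ** Y s) has_integral
      (X' t ** (Y' v ** X v) ** Y s - X' t ** (Y' u ** X u) ** Y s)) {u..v}"
    by (intro antiderivative_has_integral antiderivative_linear[OF lin]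
        antiderivative_bilinear[OF bounded_bilinear_matrix_matrix_mult] XY XY' assms)
  then have "((\<lambda>r. transition_matrix A' t r ** (A r - A' r) ** transition_matrix A r s) has_integral
      (X' t ** (Y' v ** X v) ** Y s - X' t ** (Y' u ** X u) ** Y s)) {u..v}"
    by (rule has_integral_eq[rotated])
       (use nonneg in \<open>simp add: eqs m.minus_left m.minus_right m.add_left m.add_right m.diff_left m.diff_right
          matrix_mul_assoc\<close>)
  then show ?thesis
    using assms by (simp add: eqs matrix_mul_assoc)
qed

subsection \<open>Growth under perturbation\<close>

lemma norm_matrix_vector_mult_le: "norm (M *v x) \<le> matrix_onorm M * norm x"
  by (rule onorm) simp

text \<open>In the inner product of \<open>x v* M\<close> with itself one factor \<open>M\<close>
  moves to the other side; Cauchy-Schwarz and cancellation of one factor give the bound.\<close>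

lemma norm_vector_matrix_mult_le: "norm (x v* M) \<le> matrix_onorm M * norm x"
proof (cases "x v* M = 0")
  case True
  then show ?thesis by (simp add: onorm_pos_le)
next
  case False
  have "norm (x v* M) * norm (x v* M) = x \<bullet> (M *v (x v* M))"
    by (simp add: dot_lmul_matrix[symmetric] dot_square_norm power2_eq_square)
  also have "\<dots> \<le> norm x * (matrix_onorm M * norm (x v* M))"
    by (intro order_trans[OF norm_cauchy_schwarz] mult_left_mono norm_matrix_vector_mult_le) simp
  finally have "norm (x v* M) * norm (x v* M) \<le> (matrix_onorm M * norm x) * norm (x v* M)"
    by (simp add: mult_ac)
  then show ?thesis using False by (simp add: mult_le_cancel_right)
qed

lemma matrix_onorm_transpose: "matrix_onorm (transpose M) = matrix_onorm M"
proof -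
  have "matrix_onorm (transpose N) \<le> matrix_onorm N" for N :: "real^'k^'m"
    using norm_vector_matrix_mult_le by (intro onorm_le) (simp add: transpose_matrix_vector)
  from this[of M] show ?thesis
    using norm_vector_matrix_mult_le[of _ "transpose M"]
    by (intro antisym[OF _ onorm_le]) auto
qed

section \<open>Gronwall estimates and growth of the perturbed system\<close>

text \<open>The weight C exp(-\<gamma> r) has total mass C / \<gamma> on the half-line, so the
  Gronwall factor does not depend on \<open>T\<close>.\<close>

lemma gronwall_exponential_kernel:
  fixes f :: "real \<Rightarrow> real"
  assumes f: "continuous_on {s..T} f" and "0 \<le> s" "s \<le> T" "0 \<le> C" "0 < \<gamma>" "0 \<le> c"
    and le: "\<And>t. s \<le> t \<Longrightarrow> t \<le> T \<Longrightarrow> f t \<le> c + integral {s..t} (\<lambda>r. C * exp (- \<gamma> * r) * f r)"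
    and nonneg: "\<And>t. s \<le> t \<Longrightarrow> t \<le> T \<Longrightarrow> 0 \<le> f t"
  shows "f T \<le> c * exp (C / \<gamma>)"
proof -
  define k where "k = (\<lambda>r. C * exp (- \<gamma> * r) * f r)"
  define G where "G = (\<lambda>t. c + integral {s..t} k)"
  \<comment> \<open>Integrating factor: h' = - C exp(-\<gamma> t) h, hence (G h)' = C exp(-\<gamma>
    t) h (f - G), which is nonpositive by the hypothesis on \<open>f\<close>.\<close>
  define h where "h = (\<lambda>t. exp (C / \<gamma> * exp (- \<gamma> * t)))"
  have k: "continuous_on {s..T} k" unfolding k_def by (intro continuous_intros f)
  have deriv: "((\<lambda>t. G t * h t) has_real_derivative C * exp (- \<gamma> * t) * h t * (f t - G t)) (at t within {s..T})"
    if "t \<in> {s..T}" for t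
  proof -
    have G': "(G has_real_derivative k t) (at t within {s..T})"
      unfolding G_def using integral_has_real_derivative[OF k that]
      by (auto intro!: derivative_eq_intros)
    have h': "(h has_real_derivative - C * exp (- \<gamma> * t) * h t) (at t within {s..T})"
      unfolding h_def using \<open>0 < \<gamma>\<close> by (auto intro!: derivative_eq_intros)
    show ?thesis
      by (rule DERIV_cong[OF DERIV_mult[OF G' h']]) (simp add: k_def algebra_simps)
  qed
  have "G s * h s \<ge> G T * h T"
  proof (rule DERIV_nonpos_imp_decreasing_open[where f = "\<lambda>t. G t * h t"])
    show "continuous_on {s..T} (\<lambda>t. G t * h t)"
      by (rule DERIV_continuous_on[OF deriv])
    fix t assume t: "s < t" "t < T"
    have "((\<lambda>t. G t * h t) has_real_derivative C * exp (- \<gamma> * t) * h t * (f t - G t)) (at t)"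
      using deriv[of t] t by (simp add: at_within_Icc_at)
    moreover have "C * exp (- \<gamma> * t) * h t * (f t - G t) \<le> 0"
      using le[of t] t \<open>0 \<le> C\<close> by (intro mult_nonneg_nonpos) (auto simp: G_def h_def k_def)
    ultimately show "\<exists>y. ((\<lambda>t. G t * h t) has_real_derivative y) (at t) \<and> y \<le> 0" by blast
  qed fact
  moreover have "G s * h s \<le> c * exp (C / \<gamma>)"
  proof -
    have "h s \<le> exp (C / \<gamma>)"
      unfolding h_def exp_le_cancel_iff using assms by (intro mult_left_le) auto
    then show ?thesis using assms by (simp add: G_def mult_left_mono)
  qed
  moreover have "f T \<le> G T" using le[of T] \<open>s \<le> T\<close> by (simp add: G_def k_def)
  moreover have "G T \<le> G T * h T"
  proof -
    have "0 \<le> f T" using nonneg \<open>s \<le> T\<close> by simp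
    then have "0 \<le> G T" using \<open>f T \<le> G T\<close> by linarith
    moreover have "1 \<le> h T" using \<open>0 \<le> C\<close> \<open>0 < \<gamma>\<close> by (simp add: h_def)
    ultimately show ?thesis by (simp add: mult_le_cancel_left1)
  qed
  ultimately show ?thesis by linarith
qed

text \<open>The weight \<open>m\<close> is the growth rate of the unperturbed \<open>w\<close>.
  Dividing by \<open>m t\<close> turns the Volterra equation v = w + \<integral> g into a Gronwall
  inequality for |v| / m, so \<open>v\<close> inherits the rate \<open>m\<close> with a larger
  constant.\<close>

lemma gronwall_perturbation:
  fixes v w :: "real \<Rightarrow> 'a::euclidean_space"
  assumes v: "continuous_on {s..T} v" and m: "continuous_on {s..T} m" "\<And>t. m t > 0"
    and sT: "0 \<le> s" "s \<le> T" and C: "0 \<le> C" "0 < \<gamma>" "0 \<le> c"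
    and int: "\<And>t. s \<le> t \<Longrightarrow> t \<le> T \<Longrightarrow> (g t has_integral v t - w t) {s..t}"
    and w: "\<And>t. s \<le> t \<Longrightarrow> t \<le> T \<Longrightarrow> norm (w t) \<le> c * m t"
    and g: "\<And>t r. s \<le> r \<Longrightarrow> r \<le> t \<Longrightarrow> t \<le> T \<Longrightarrow>
      norm (g t r) \<le> C * exp (- \<gamma> * r) * (norm (v r) / m r) * m t"
  shows "norm (v T) \<le> c * exp (C / \<gamma>) * m T"
proof -
  define f where "f = (\<lambda>t. norm (v t) / m t)"
  have m0: "m t \<noteq> 0" for t using m(2)[of t] by simp
  have f: "continuous_on {s..T} f"
    unfolding f_def by (intro continuous_intros v m) (use m0 in auto)
  have "f T \<le> c * exp (C / \<gamma>)"
  proof (rule gronwall_exponential_kernel[OF f sT C])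
    fix t assume t: "s \<le> t" "t \<le> T"
    show "0 \<le> f t" using m(2)[of t] by (simp add: f_def)
    have kint: "(\<lambda>r. C * exp (- \<gamma> * r) * f r) integrable_on {s..t}"
      by (intro integrable_continuous_real continuous_intros continuous_on_subset[OF f]) (use t in auto)
    have "norm (v t - w t) \<le> integral {s..t} (\<lambda>r. C * exp (- \<gamma> * r) * f r * m t)"
      using int[OF t] g t kint unfolding f_def
      by (intro
          Henstock_Kurzweil_Integration.integral_norm_bound_integral[of "g t" "{s..t}", unfolded integral_unique[OF int[OF t]]]
          integrable_on_mult_left) auto
    also have "\<dots> = integral {s..t} (\<lambda>r. C * exp (- \<gamma> * r) * f r) * m t" by simp
    finally have "norm (v t) \<le> (c + integral {s..t} (\<lambda>r. C * exp (- \<gamma> * r) * f r)) * m t"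
      using w[OF t] norm_triangle_sub[of "v t" "w t"] by (simp add: algebra_simps)
    then show "f t \<le> c + integral {s..t} (\<lambda>r. C * exp (- \<gamma> * r) * f r)"
      using m(2)[of t] by (simp add: f_def pos_divide_le_eq)
  qed
  then show ?thesis using m(2)[of T] by (simp add: f_def pos_divide_le_eq)
qed

text \<open>Resolves the absolute value. The nonuniform weight sits at the second argument, hence at
  the later time \<open>t\<close> in the backward case.\<close>

lemma nonuniform_bounded_growth_forward:
  assumes "nonuniform_bounded_growth A K a \<epsilon>" "0 \<le> s" "s \<le> t"
  shows "matrix_onorm (transition_matrix A t s) \<le> K * exp (\<epsilon> * s) * exp (a * (t - s))"
    and "matrix_onorm (transition_matrix A s t) \<le> K * exp (\<epsilon> * t) * exp (a * (t - s))"
proof -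
  have growth: "matrix_onorm (transition_matrix A t \<tau>) \<le> K * exp (\<epsilon> * \<tau>) * exp (a * \<bar>t - \<tau>\<bar>)"
    if "t \<ge> 0" "\<tau> \<ge> 0" for t \<tau>
    using assms(1) that unfolding nonuniform_bounded_growth_def by blast
  show "matrix_onorm (transition_matrix A t s) \<le> K * exp (\<epsilon> * s) * exp (a * (t - s))"
    "matrix_onorm (transition_matrix A s t) \<le> K * exp (\<epsilon> * t) * exp (a * (t - s))"
    using growth[of t s] growth[of s t] assms by simp_all
qed

lemma norm_matrix_vector_mult_bound:
  assumes "matrix_onorm M \<le> c" "norm x \<le> d" "0 \<le> c"
  shows "norm (M *v x) \<le> c * d"
  using assms norm_matrix_vector_mult_le[of M x] by (meson mult_mono norm_ge_zero order_trans)

lemma norm_vector_matrix_mult_bound: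
  assumes "matrix_onorm M \<le> c" "norm x \<le> d" "0 \<le> c"
  shows "norm (x v* M) \<le> c * d"
  using assms norm_vector_matrix_mult_le[of x M] by (meson mult_mono norm_ge_zero order_trans)

text \<open>Of the decay exp(-(\<epsilon> + \<gamma>) r) of the perturbation, the part
  exp(-\<epsilon> r) cancels the nonuniform weight of \<Phi> and exp(-\<gamma> r) remains as an
  integrable Gronwall kernel. Thus only the constant \<open>K\<close> changes.\<close>

lemma nonuniform_bounded_growth_perturbation:
  fixes A E :: "real \<Rightarrow> real^'n^'n"
  assumes A: "measurable_locally_bounded A" and A': "measurable_locally_bounded A'"
    and growth: "nonuniform_bounded_growth A K a \<epsilon>"
    and E: "\<And>r. r \<ge> 0 \<Longrightarrow> matrix_onorm (A r - A' r) \<le> C * exp (- (\<epsilon> + \<gamma>) * r)"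
    and "0 \<le> C" "0 < \<gamma>"
  shows "nonuniform_bounded_growth A' (K * exp (K * C / \<gamma>)) a \<epsilon>"
proof -
  have pos: "K > 0" "a > 0" "\<epsilon> > 0"
    using growth by (auto simp: nonuniform_bounded_growth_def)
  have E': "matrix_onorm (A' r - A r) \<le> C * exp (- (\<epsilon> + \<gamma>) * r)" if "r \<ge> 0" for r
  proof -
    have "matrix_onorm (A' r - A r) = onorm (\<lambda>x. - ((A r - A' r) *v x))"
      by (rule arg_cong[of _ _ onorm]) (simp add: fun_eq_iff matrix_vector_mult_diff_rdistrib)
    also have "\<dots> \<le> C * exp (- (\<epsilon> + \<gamma>) * r)"
      using E[OF that] by (simp only: onorm_neg)
    finally show ?thesis .
  qed
  interpret m: bounded_bilinear "(*v) :: real^'n^'n \<Rightarrow> real^'n \<Rightarrow> real^'n"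
    by (rule bounded_bilinear_matrix_vector_mult)
  interpret vm: bounded_bilinear "(v*) :: real^'n \<Rightarrow> real^'n^'n \<Rightarrow> real^'n"
    by (rule bounded_bilinear_vector_matrix_mult)
  \<comment> \<open>Here the second argument varies and the unknown \<Phi>'(t,r) is the left factor
    of the perturbation formula, hence row vectors. The weight exp(\<epsilon> s) varies with s and
    so belongs to \<open>m\<close>.\<close>
  have backward: "norm (x v* transition_matrix A' t s) \<le>
      K * exp (K * C / \<gamma>) * exp (\<epsilon> * s) * exp (a * (s - t)) * norm x"
    if "0 \<le> t" "t \<le> s" for t s and x :: "real^'n"
  proof -
    have "norm (x v* transition_matrix A' t s) \<le> (K * norm x) * exp ((K * C) / \<gamma>) * exp (\<epsilon> * s + a * (s - t))"
    proof (rule gronwall_perturbation[where v = "\<lambda>s. x v* transition_matrix A' t s"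
          and w = "\<lambda>s. x v* transition_matrix A t s" and s = t and \<gamma> = \<gamma>
          and g = "\<lambda>s r. x v* (transition_matrix A' t r ** (A r - A' r) ** transition_matrix A r s)"
          and m = "\<lambda>s. exp (\<epsilon> * s + a * (s - t))"])
      show "continuous_on {t..s} (\<lambda>s. x v* transition_matrix A' t s)"
        by (intro vm.continuous_on continuous_on_const
            continuous_on_subset[OF transition_matrix_continuous_on(2)[OF A']]) (use that in auto)
      show "continuous_on {t..s} (\<lambda>s. exp (\<epsilon> * s + a * (s - t)))"
        by (intro continuous_intros)
      fix s assume s: "t \<le> s"
      have "((\<lambda>r. transition_matrix A' t r ** (A r - A' r) ** transition_matrix A r s) has_integral
          (transition_matrix A' t s - transition_matrix A t s)) {t..s}"
        using transition_matrix_perturbation[OF A A', of t s t s] that s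
        by (simp add: transition_matrix_self A A')
      from has_integral_linear[OF this vm.bounded_linear_right[of x]]
      show "((\<lambda>r. x v* (transition_matrix A' t r ** (A r - A' r) ** transition_matrix A r s)) has_integral
          (x v* transition_matrix A' t s - x v* transition_matrix A t s)) {t..s}"
        by (simp add: o_def vm.diff_right)
      show "norm (x v* transition_matrix A t s) \<le> K * norm x * exp (\<epsilon> * s + a * (s - t))"
        using norm_vector_matrix_mult_bound[OF nonuniform_bounded_growth_forward(2)[OF growth that(1) s] order_refl, of x] pos
        by (simp add: exp_add mult_ac)
    next
      fix s r assume r: "t \<le> r" "r \<le> s"
      let ?y = "x v* transition_matrix A' t r"
      have "norm (x v* (transition_matrix A' t r ** (A r - A' r) ** transition_matrix A r s))
          = norm ((?y v* (A r - A' r)) v* transition_matrix A r s)"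
        by (simp add: vector_matrix_mul_assoc)
      also have "\<dots> \<le> (K * exp (\<epsilon> * s) * exp (a * (s - r))) * ((C * exp (- (\<epsilon> + \<gamma>) * r)) * norm ?y)"
        using that r pos \<open>0 \<le> C\<close>
        by (intro norm_matrix_vector_mult_bound norm_vector_matrix_mult_bound E nonuniform_bounded_growth_forward[OF growth]) auto
      also have "\<dots> = K * C * exp (- \<gamma> * r) * (norm ?y / exp (\<epsilon> * r + a * (r - t))) * exp (\<epsilon> * s + a * (s - t))"
        by (simp add: exp_add exp_diff exp_minus field_simps)
      finally show "norm (x v* (transition_matrix A' t r ** (A r - A' r) ** transition_matrix A r s)) \<le> \<dots>" .
    qed (use that pos \<open>0 \<le> C\<close> \<open>0 < \<gamma>\<close> in auto)
    then show ?thesis by (simp add: exp_add mult_ac)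
  qed
  \<comment> \<open>With the two systems exchanged in the perturbation formula, the unknown
    \<Phi>'(r,s) is the right factor. The starting time s is fixed, so exp(\<epsilon> s) goes into
    the constant and \<open>m\<close> keeps only exp(a (t - s)).\<close>
  have forward: "norm (transition_matrix A' t s *v x) \<le>
      K * exp (K * C / \<gamma>) * exp (\<epsilon> * s) * exp (a * (t - s)) * norm x"
    if "0 \<le> s" "s \<le> t" for t s and x :: "real^'n"
  proof -
    have "norm (transition_matrix A' t s *v x) \<le> (K * exp (\<epsilon> * s) * norm x) * exp ((K * C) / \<gamma>) * exp (a * (t - s))"
    proof (rule gronwall_perturbation[where v = "\<lambda>t. transition_matrix A' t s *v x"
          and w = "\<lambda>t. transition_matrix A t s *v x" and s = s and \<gamma> = \<gamma>
          and g = "\<lambda>t r. (transition_matrix A t r ** (A' r - A r) ** transition_matrix A' r s) *v x"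
          and m = "\<lambda>t. exp (a * (t - s))"])
      show "continuous_on {s..t} (\<lambda>t. transition_matrix A' t s *v x)"
        by (intro m.continuous_on continuous_on_const
            continuous_on_subset[OF transition_matrix_continuous_on(1)[OF A']]) (use that in auto)
      show "continuous_on {s..t} (\<lambda>t. exp (a * (t - s)))"
        by (intro continuous_intros)
      fix t assume t: "s \<le> t"
      have "((\<lambda>r. transition_matrix A t r ** (A' r - A r) ** transition_matrix A' r s) has_integral
          (transition_matrix A' t s - transition_matrix A t s)) {s..t}"
        using transition_matrix_perturbation[OF A' A, of t s s t] that t
        by (simp add: transition_matrix_self A A')
      from has_integral_linear[OF this m.bounded_linear_left[of x]]
      show "((\<lambda>r. (transition_matrix A t r ** (A' r - A r) ** transition_matrix A' r s) *v x) has_integral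
          (transition_matrix A' t s *v x - transition_matrix A t s *v x)) {s..t}"
        by (simp add: o_def m.diff_left)
      show "norm (transition_matrix A t s *v x) \<le> K * exp (\<epsilon> * s) * norm x * exp (a * (t - s))"
        using norm_matrix_vector_mult_bound[OF nonuniform_bounded_growth_forward(1)[OF growth that(1) t] order_refl, of x] pos
        by (simp add: mult_ac)
    next
      fix t r assume r: "s \<le> r" "r \<le> t"
      let ?y = "transition_matrix A' r s *v x"
      have "norm ((transition_matrix A t r ** (A' r - A r) ** transition_matrix A' r s) *v x)
          = norm (transition_matrix A t r *v ((A' r - A r) *v ?y))"
        by (simp add: matrix_vector_mul_assoc matrix_mul_assoc)
      also have "\<dots> \<le> (K * exp (\<epsilon> * r) * exp (a * (t - r))) * ((C * exp (- (\<epsilon> + \<gamma>) * r)) * norm ?y)"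
        using that r pos \<open>0 \<le> C\<close>
        by (intro norm_matrix_vector_mult_bound norm_vector_matrix_mult_bound E' nonuniform_bounded_growth_forward[OF growth]) auto
      also have "\<dots> = K * C * exp (- \<gamma> * r) * (norm ?y / exp (a * (r - s))) * exp (a * (t - s))"
        by (simp add: exp_add exp_diff exp_minus field_simps)
      finally show "norm ((transition_matrix A t r ** (A' r - A r) ** transition_matrix A' r s) *v x) \<le> \<dots>" .
    qed (use that pos \<open>0 \<le> C\<close> \<open>0 < \<gamma>\<close> in auto)
    then show ?thesis by (simp add: mult_ac)
  qed
  have "matrix_onorm (transition_matrix A' t s) \<le> K * exp (K * C / \<gamma>) * exp (\<epsilon> * s) * exp (a * \<bar>t - s\<bar>)"
    if ts: "t \<ge> 0" "s \<ge> 0" for t s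
  proof (cases "s \<le> t")
    case True
    then show ?thesis using forward[OF ts(2) True] by (intro onorm_le) simp
  next
    case False
    then have "matrix_onorm (transpose (transition_matrix A' t s))
        \<le> K * exp (K * C / \<gamma>) * exp (\<epsilon> * s) * exp (a * \<bar>t - s\<bar>)"
      using backward[OF ts(1), of s] by (intro onorm_le) simp
    then show ?thesis by (simp add: matrix_onorm_transpose)
  qed
  then show ?thesis using pos by (simp add: nonuniform_bounded_growth_def)
qed

subsection \<open>Gramians\<close>

lemma bounded_linear_quadratic_form: "bounded_linear (\<lambda>M :: real^'n^'n. x \<bullet> (M *v y))"
  by (intro bounded_linear_compose[OF bounded_linear_inner_right]
      bounded_bilinear.bounded_linear_left[OF bounded_bilinear_matrix_vector_mult])

lemma gramian_W_integrand_integrable: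
  fixes A :: "real \<Rightarrow> real^'n^'n" and B :: "real \<Rightarrow> real^'p^'n"
  assumes A: "measurable_locally_bounded A" and B: "measurable_locally_bounded B" and t: "0 \<le> t" "0 \<le> t\<^sub>0"
  shows "(\<lambda>s. transition_matrix A t s ** B s ** transpose (B s) ** transpose (transition_matrix A t s))
    integrable_on {t\<^sub>0..t\<^sub>1}"
  by (intro measurable_locally_bounded_integrable[OF _ t(2)]
      measurable_locally_bounded_bilinear[OF bounded_bilinear_matrix_matrix_mult]
      measurable_locally_bounded_linear[OF bounded_linear_transpose] B
      measurable_locally_bounded_continuous transition_matrix_continuous_on[OF A t(1)])

text \<open>The functional M \<mapsto> x \<bullet> M x is linear and commutes with the integral, so
  Gramians can be compared through scalar integrands.\<close>

lemma gramian_W_quadratic_form: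
  fixes A :: "real \<Rightarrow> real^'n^'n" and B :: "real \<Rightarrow> real^'p^'n"
  assumes A: "measurable_locally_bounded A" and B: "measurable_locally_bounded B" and t: "0 \<le> t\<^sub>0"
  shows "((\<lambda>s. (norm (x v* transition_matrix A t\<^sub>0 s v* B s))\<^sup>2) has_integral
    x \<bullet> (gramian_W A B t\<^sub>0 t\<^sub>1 *v x)) {t\<^sub>0..t\<^sub>1}"
proof -
  have eq: "x \<bullet> ((\<Phi> ** N ** transpose N ** transpose \<Phi>) *v x) = (norm (x v* \<Phi> v* N))\<^sup>2"
    for \<Phi> :: "real^'n^'n" and N :: "real^'p^'n"
    by (simp add: matrix_vector_mul_assoc[symmetric] dot_lmul_matrix[symmetric] power2_norm_eq_inner)
  show ?thesis
    using has_integral_linear[OF integrable_integral[OF gramian_W_integrand_integrable[OF A B t t]]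
        bounded_linear_quadratic_form[of x x], of t\<^sub>1]
    by (simp add: o_def eq gramian_W_def)
qed

lemma gramian_W_symmetric:
  fixes A :: "real \<Rightarrow> real^'n^'n" and B :: "real \<Rightarrow> real^'p^'n"
  assumes A: "measurable_locally_bounded A" and B: "measurable_locally_bounded B" and t: "0 \<le> t\<^sub>0"
  shows "transpose (gramian_W A B t\<^sub>0 t\<^sub>1) = gramian_W A B t\<^sub>0 t\<^sub>1"
  using integral_linear[OF gramian_W_integrand_integrable[OF A B t t, of t\<^sub>1] bounded_linear_transpose]
  by (simp add: gramian_W_def o_def matrix_transpose_mul matrix_mul_assoc)

lemma gramian_K_symmetric:
  fixes A :: "real \<Rightarrow> real^'n^'n" and B :: "real \<Rightarrow> real^'p^'n"
  assumes A: "measurable_locally_bounded A" and B: "measurable_locally_bounded B" and t: "0 \<le> t\<^sub>0"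
  shows "transpose (gramian_K A B t\<^sub>0 t\<^sub>1) = gramian_K A B t\<^sub>0 t\<^sub>1"
  using gramian_W_symmetric[OF assms, of t\<^sub>1]
  by (simp add: gramian_K_def matrix_transpose_mul matrix_mul_assoc)

text \<open>Conjugation by \<Phi> moves onto the vector, so bounds on \<open>gramian_K\<close>
  follow from bounds on \<open>gramian_W\<close> and on \<Phi>.\<close>

lemma gramian_K_quadratic_form:
  "x \<bullet> (gramian_K A B t\<^sub>0 t\<^sub>1 *v x) = (x v* transition_matrix A t\<^sub>1 t\<^sub>0) \<bullet>
    (gramian_W A B t\<^sub>0 t\<^sub>1 *v (x v* transition_matrix A t\<^sub>1 t\<^sub>0))"
  by (simp add: gramian_K_def matrix_vector_mul_assoc[symmetric] dot_lmul_matrix[symmetric])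

lemma transpose_diff: "transpose (M - N :: real^'k^'m) = transpose M - transpose N"
  by (simp add: transpose_def vec_eq_iff)

text \<open>For symmetric \<open>M\<close> the symmetry clause of \<open>pos_semidef\<close> is
  automatic, which leaves the inequality between quadratic forms.\<close>

lemma loewner_le_scaled_identity:
  fixes M :: "real^'n^'n"
  assumes "transpose M = M"
  shows "c *\<^sub>R mat 1 \<preceq> M \<longleftrightarrow> (\<forall>x. c * (norm x)\<^sup>2 \<le> x \<bullet> (M *v x))"
    and "M \<preceq> c *\<^sub>R mat 1 \<longleftrightarrow> (\<forall>x. x \<bullet> (M *v x) \<le> c * (norm x)\<^sup>2)"
proof -
  have "transpose (c *\<^sub>R mat 1 :: real^'n^'n) = c *\<^sub>R mat 1"
    by (simp add: transpose_def mat_def vec_eq_iff)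
  then show "c *\<^sub>R mat 1 \<preceq> M \<longleftrightarrow> (\<forall>x. c * (norm x)\<^sup>2 \<le> x \<bullet> (M *v x))"
    "M \<preceq> c *\<^sub>R mat 1 \<longleftrightarrow> (\<forall>x. x \<bullet> (M *v x) \<le> c * (norm x)\<^sup>2)"
    using assms
    by (simp_all add: loewner_le_def pos_semidef_def transpose_diff matrix_vector_mult_diff_rdistrib
        inner_diff_right scaleR_matrix_vector_assoc[symmetric] power2_norm_eq_inner)
qed

section \<open>Reduction of controllability to a lower bound on W\<close>

text \<open>The first of the four inequalities of controllability, as a statement on quadratic
  forms; the other three will be consequences of growth and decay.\<close>

definition gramian_W_bounded_below :: "(real \<Rightarrow> real^'n^'n) \<Rightarrow> (real \<Rightarrow> real^'p^'n) \<Rightarrow> bool" where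
  "gramian_W_bounded_below A B \<longleftrightarrow>
     (\<exists>\<mu>\<ge>0. \<exists>\<alpha>. (\<forall>\<sigma>\<ge>0. \<alpha> \<sigma> > 0) \<and> (\<forall>t\<ge>0. \<exists>\<sigma>\<^sub>0>0. \<forall>\<sigma>\<ge>\<sigma>\<^sub>0. \<forall>x.
        exp (- 2 * \<mu> * t) * \<alpha> \<sigma> * (norm x)\<^sup>2 \<le> x \<bullet> (gramian_W A B t (t + \<sigma>) *v x)))"

text \<open>As \<epsilon> \<le> \<beta>, the decay of \<open>B\<close> beats the nonuniform weight
  of \<Phi>, which bounds W above. The bounds on K follow by estimating \<Phi>(t + \<sigma>, t) and
  its inverse.\<close>

lemma nonuniformly_completely_controllable_iff:
  fixes A :: "real \<Rightarrow> real^'n^'n" and B :: "real \<Rightarrow> real^'p^'n"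
  assumes A: "measurable_locally_bounded A" and B: "measurable_locally_bounded B"
    and growth: "nonuniform_bounded_growth A K a \<epsilon>"
    and Bdecay: "\<And>z. z \<ge> 0 \<Longrightarrow> matrix_onorm (B z) \<le> b * exp (- \<beta> * z)"
    and b: "b > 0" "\<epsilon> \<le> \<beta>"
  shows "nonuniformly_completely_controllable A B \<longleftrightarrow> gramian_W_bounded_below A B"
proof
  assume "nonuniformly_completely_controllable A B"
  then obtain \<mu>\<^sub>0 \<mu>\<^sub>1 \<nu>\<^sub>0 \<nu>\<^sub>1 \<alpha>\<^sub>0 \<beta>\<^sub>0 \<alpha>\<^sub>1 \<beta>\<^sub>1 where
    "\<mu>\<^sub>0 \<ge> 0" and "\<forall>\<sigma>\<ge>0. \<alpha>\<^sub>0 \<sigma> > 0 \<and> \<beta>\<^sub>0 \<sigma> > 0 \<and> \<alpha>\<^sub>1 \<sigma> > 0 \<and> \<beta>\<^sub>1 \<sigma> > 0"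
    and bounds: "\<forall>t\<ge>0. \<exists>\<sigma>\<^sub>0>0. \<forall>\<sigma>\<ge>\<sigma>\<^sub>0.
      (exp (- 2 * \<mu>\<^sub>0 * t) * \<alpha>\<^sub>0 \<sigma>) *\<^sub>R mat 1 \<preceq> gramian_W A B t (t + \<sigma>) \<and>
      gramian_W A B t (t + \<sigma>) \<preceq> (exp (2 * \<mu>\<^sub>1 * t) * \<alpha>\<^sub>1 \<sigma>) *\<^sub>R mat 1 \<and>
      (exp (- 2 * \<nu>\<^sub>0 * t) * \<beta>\<^sub>0 \<sigma>) *\<^sub>R mat 1 \<preceq> gramian_K A B t (t + \<sigma>) \<and>
      gramian_K A B t (t + \<sigma>) \<preceq> (exp (2 * \<nu>\<^sub>1 * t) * \<beta>\<^sub>1 \<sigma>) *\<^sub>R mat 1"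
    unfolding nonuniformly_completely_controllable_def by (elim exE conjE) (rule that; assumption)
  moreover have "\<exists>\<sigma>\<^sub>0>0. \<forall>\<sigma>\<ge>\<sigma>\<^sub>0. \<forall>x.
      exp (- 2 * \<mu>\<^sub>0 * t) * \<alpha>\<^sub>0 \<sigma> * (norm x)\<^sup>2 \<le> x \<bullet> (gramian_W A B t (t + \<sigma>) *v x)" if "t \<ge> 0" for t
    using bounds that loewner_le_scaled_identity(1)[OF gramian_W_symmetric[OF A B that]] by meson
  ultimately show "gramian_W_bounded_below A B"
    unfolding gramian_W_bounded_below_def by (intro exI[of _ \<mu>\<^sub>0] conjI exI[of _ \<alpha>\<^sub>0]) auto
next
  assume "gramian_W_bounded_below A B"
  then obtain \<mu> \<alpha> where \<mu>: "\<mu> \<ge> 0" and \<alpha>: "\<And>\<sigma>. \<sigma> \<ge> 0 \<Longrightarrow> \<alpha> \<sigma> > 0"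
    and lower: "\<And>t. t \<ge> 0 \<Longrightarrow> \<exists>\<sigma>\<^sub>0>0. \<forall>\<sigma>\<ge>\<sigma>\<^sub>0. \<forall>x.
        exp (- 2 * \<mu> * t) * \<alpha> \<sigma> * (norm x)\<^sup>2 \<le> x \<bullet> (gramian_W A B t (t + \<sigma>) *v x)"
    unfolding gramian_W_bounded_below_def by blast
  have pos: "K > 0" "a > 0" "\<epsilon> > 0"
    using growth by (auto simp: nonuniform_bounded_growth_def)
  \<comment> \<open>\<open>\<alpha>\<^sub>1\<close> is the squared integrand bound times the
    interval length, where + 1 keeps it positive at \<sigma> = 0. \<open>\<beta>\<^sub>0\<close>
    divides \<alpha> by the \<sigma>-part of the squared backward growth, and
    \<open>\<beta>\<^sub>1\<close> multiplies \<open>\<alpha>\<^sub>1\<close> by that of the forward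
    growth.\<close>
  define \<alpha>\<^sub>1 where "\<alpha>\<^sub>1 = (\<lambda>\<sigma>. (K * b * exp (a * \<sigma>))\<^sup>2 * (\<bar>\<sigma>\<bar> + 1))"
  define \<beta>\<^sub>0 where "\<beta>\<^sub>0 = (\<lambda>\<sigma>. \<alpha> \<sigma> / (K * exp ((\<epsilon> + a) * \<sigma>))\<^sup>2)"
  define \<beta>\<^sub>1 where "\<beta>\<^sub>1 = (\<lambda>\<sigma>. \<alpha>\<^sub>1 \<sigma> * (K * exp (a * \<sigma>))\<^sup>2)"
  have upper: "x \<bullet> (gramian_W A B t (t + \<sigma>) *v x) \<le> \<alpha>\<^sub>1 \<sigma> * (norm x)\<^sup>2"
    if "t \<ge> 0" "\<sigma> \<ge> 0" for t \<sigma> x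
  proof -
    have "((\<lambda>_. (K * b * exp (a * \<sigma>) * norm x)\<^sup>2) has_integral \<sigma> * (K * b * exp (a * \<sigma>) * norm x)\<^sup>2) {t..t + \<sigma>}"
      using has_integral_const_real[of "(K * b * exp (a * \<sigma>) * norm x)\<^sup>2" t "t + \<sigma>"] that by simp
    then have "x \<bullet> (gramian_W A B t (t + \<sigma>) *v x) \<le> \<sigma> * (K * b * exp (a * \<sigma>) * norm x)\<^sup>2"
    proof (rule has_integral_le[OF gramian_W_quadratic_form[OF A B that(1)]])
      fix s assume s: "s \<in> {t..t + \<sigma>}"
      have "norm (x v* transition_matrix A t s v* B s)
          \<le> b * exp (- \<beta> * s) * (K * exp (\<epsilon> * s) * exp (a * (s - t)) * norm x)"
        by (intro norm_matrix_vector_mult_bound norm_vector_matrix_mult_bound Bdecay nonuniform_bounded_growth_forward[OF growth])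
           (use s that pos b in auto)
      also have "\<dots> = (K * b * norm x) * exp (a * (s - t) - (\<beta> - \<epsilon>) * s)"
        by (simp add: algebra_simps exp_add[symmetric] exp_diff[symmetric] flip: exp_minus)
      also have "\<dots> \<le> (K * b * norm x) * exp (a * \<sigma>)"
      proof (intro mult_left_mono)
        have "a * (s - t) \<le> a * \<sigma>" "0 \<le> (\<beta> - \<epsilon>) * s"
          using s that pos b by auto
        then show "exp (a * (s - t) - (\<beta> - \<epsilon>) * s) \<le> exp (a * \<sigma>)" by simp
      qed (use pos b in auto)
      finally show "(norm (x v* transition_matrix A t s v* B s))\<^sup>2 \<le> (K * b * exp (a * \<sigma>) * norm x)\<^sup>2"
        by (intro power_mono) (simp_all add: mult_ac)
    qed
    also have "\<dots> \<le> \<alpha>\<^sub>1 \<sigma> * (norm x)\<^sup>2"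
      using that by (simp add: \<alpha>\<^sub>1_def power_mult_distrib algebra_simps)
    finally show ?thesis .
  qed
  have K_lower: "exp (- 2 * (\<mu> + \<epsilon>) * t) * \<beta>\<^sub>0 \<sigma> * (norm x)\<^sup>2 \<le> x \<bullet> (gramian_K A B t (t + \<sigma>) *v x)"
    if t: "t \<ge> 0" "\<sigma> \<ge> 0" and W: "\<And>x. exp (- 2 * \<mu> * t) * \<alpha> \<sigma> * (norm x)\<^sup>2 \<le> x \<bullet> (gramian_W A B t (t + \<sigma>) *v x)"
    for t \<sigma> x
  proof -
    define y where "y = x v* transition_matrix A (t + \<sigma>) t"
    \<comment> \<open>The bound on \<Phi>(t, t + \<sigma>), split into a \<sigma>-part absorbed by
      \<open>\<beta>\<^sub>0\<close> and the factor exp(\<epsilon> t), which raises the exponent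
      from \<mu> to \<mu> + \<epsilon>.\<close>
    define c where "c = K * exp ((\<epsilon> + a) * \<sigma>) * exp (\<epsilon> * t)"
    have "c > 0" using pos by (simp add: c_def)
    \<comment> \<open>Recovering x from y through the inverse transition matrix bounds |y| from
      below.\<close>
    have "x = y v* transition_matrix A t (t + \<sigma>)"
      using t by (simp add: y_def vector_matrix_mul_assoc transition_matrix_compose[OF A] transition_matrix_self[OF A])
    then have "norm x \<le> c * norm y"
      using norm_vector_matrix_mult_bound[OF nonuniform_bounded_growth_forward(2)[OF growth, of t "t + \<sigma>"] order_refl, of y] t pos
      by (simp add: c_def exp_add[symmetric] mult.assoc algebra_simps)
    then have "(norm x)\<^sup>2 \<le> c\<^sup>2 * (norm y)\<^sup>2"
      by (metis norm_ge_zero power_mono power_mult_distrib)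
    then have "(norm x)\<^sup>2 / c\<^sup>2 \<le> (norm y)\<^sup>2"
      using \<open>c > 0\<close> by (simp add: pos_divide_le_eq mult.commute)
    then have "exp (- 2 * \<mu> * t) * \<alpha> \<sigma> * ((norm x)\<^sup>2 / c\<^sup>2) \<le> exp (- 2 * \<mu> * t) * \<alpha> \<sigma> * (norm y)\<^sup>2"
      using \<alpha>[OF t(2)] by (intro mult_left_mono) auto
    also have "\<dots> \<le> x \<bullet> (gramian_K A B t (t + \<sigma>) *v x)"
      using W[of y] by (simp add: gramian_K_quadratic_form y_def)
    also have "exp (- 2 * \<mu> * t) * \<alpha> \<sigma> * ((norm x)\<^sup>2 / c\<^sup>2) = exp (- 2 * (\<mu> + \<epsilon>) * t) * \<beta>\<^sub>0 \<sigma> * (norm x)\<^sup>2"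
    proof -
      have "exp (- 2 * (\<mu> + \<epsilon>) * t) = exp (- 2 * \<mu> * t) / (exp (\<epsilon> * t))\<^sup>2"
        by (simp add: power2_eq_square exp_add[symmetric] exp_diff[symmetric] algebra_simps)
      then show ?thesis by (simp add: c_def \<beta>\<^sub>0_def power_mult_distrib)
    qed
    finally show ?thesis .
  qed
  have K_upper: "x \<bullet> (gramian_K A B t (t + \<sigma>) *v x) \<le> exp (2 * \<epsilon> * t) * \<beta>\<^sub>1 \<sigma> * (norm x)\<^sup>2"
    if t: "t \<ge> 0" "\<sigma> \<ge> 0" for t \<sigma> x
  proof -
    define y where "y = x v* transition_matrix A (t + \<sigma>) t"
    have "norm y \<le> K * exp (\<epsilon> * t) * exp (a * \<sigma>) * norm x"
      unfolding y_def
      using norm_vector_matrix_mult_bound[OF nonuniform_bounded_growth_forward(1)[OF growth, of t "t + \<sigma>"] order_refl, of x] t pos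
      by simp
    then have "(norm y)\<^sup>2 \<le> (K * exp (\<epsilon> * t) * exp (a * \<sigma>) * norm x)\<^sup>2"
      by (intro power_mono) auto
    moreover have "\<alpha>\<^sub>1 \<sigma> \<ge> 0" by (simp add: \<alpha>\<^sub>1_def)
    ultimately have "\<alpha>\<^sub>1 \<sigma> * (norm y)\<^sup>2 \<le> \<alpha>\<^sub>1 \<sigma> * (K * exp (\<epsilon> * t) * exp (a * \<sigma>) * norm x)\<^sup>2"
      by (rule mult_left_mono)
    also have "\<dots> = exp (2 * \<epsilon> * t) * \<beta>\<^sub>1 \<sigma> * (norm x)\<^sup>2"
      by (simp add: \<beta>\<^sub>1_def power_mult_distrib exp_double[symmetric] mult_ac)
    finally show ?thesis
      using upper[OF t, of y] by (simp add: gramian_K_quadratic_form y_def)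
  qed
  have posfun: "\<alpha> \<sigma> > 0 \<and> \<beta>\<^sub>0 \<sigma> > 0 \<and> \<alpha>\<^sub>1 \<sigma> > 0 \<and> \<beta>\<^sub>1 \<sigma> > 0" if "\<sigma> \<ge> 0" for \<sigma>
    using \<alpha>[OF that] pos b that by (simp add: \<alpha>\<^sub>1_def \<beta>\<^sub>0_def \<beta>\<^sub>1_def)
  \<comment> \<open>The exponents are \<mu>, 0, \<mu> + \<epsilon> and \<epsilon>; the 0 reflects
    that the upper bound on W is uniform in t.\<close>
  have main: "\<exists>\<sigma>\<^sub>0>0. \<forall>\<sigma>\<ge>\<sigma>\<^sub>0.
      (exp (- 2 * \<mu> * t) * \<alpha> \<sigma>) *\<^sub>R mat 1 \<preceq> gramian_W A B t (t + \<sigma>) \<and>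
      gramian_W A B t (t + \<sigma>) \<preceq> (exp (2 * 0 * t) * \<alpha>\<^sub>1 \<sigma>) *\<^sub>R mat 1 \<and>
      (exp (- 2 * (\<mu> + \<epsilon>) * t) * \<beta>\<^sub>0 \<sigma>) *\<^sub>R mat 1 \<preceq> gramian_K A B t (t + \<sigma>) \<and>
      gramian_K A B t (t + \<sigma>) \<preceq> (exp (2 * \<epsilon> * t) * \<beta>\<^sub>1 \<sigma>) *\<^sub>R mat 1" if t: "t \<ge> 0" for t
  proof -
    obtain \<sigma>\<^sub>0 where \<sigma>\<^sub>0: "\<sigma>\<^sub>0 > 0" "\<And>\<sigma> x. \<sigma> \<ge> \<sigma>\<^sub>0 \<Longrightarrow>
        exp (- 2 * \<mu> * t) * \<alpha> \<sigma> * (norm x)\<^sup>2 \<le> x \<bullet> (gramian_W A B t (t + \<sigma>) *v x)"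
      using lower[OF t] by blast
    show ?thesis
    proof (intro exI[of _ \<sigma>\<^sub>0] conjI allI impI \<sigma>\<^sub>0(1))
      fix \<sigma> assume "\<sigma> \<ge> \<sigma>\<^sub>0"
      then have \<sigma>: "\<sigma> \<ge> \<sigma>\<^sub>0" "\<sigma> \<ge> 0" using \<sigma>\<^sub>0(1) by auto
      note W = loewner_le_scaled_identity[OF gramian_W_symmetric[OF A B t]]
      note K = loewner_le_scaled_identity[OF gramian_K_symmetric[OF A B t]]
      show "(exp (- 2 * \<mu> * t) * \<alpha> \<sigma>) *\<^sub>R mat 1 \<preceq> gramian_W A B t (t + \<sigma>)"
        unfolding W using \<sigma>\<^sub>0(2)[OF \<sigma>(1)] by blast
      show "gramian_W A B t (t + \<sigma>) \<preceq> (exp (2 * 0 * t) * \<alpha>\<^sub>1 \<sigma>) *\<^sub>R mat 1"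
        unfolding W using upper[OF t \<sigma>(2)] by simp
      show "(exp (- 2 * (\<mu> + \<epsilon>) * t) * \<beta>\<^sub>0 \<sigma>) *\<^sub>R mat 1 \<preceq> gramian_K A B t (t + \<sigma>)"
        unfolding K using K_lower[OF t \<sigma>(2) \<sigma>\<^sub>0(2)[OF \<sigma>(1)]] by blast
      show "gramian_K A B t (t + \<sigma>) \<preceq> (exp (2 * \<epsilon> * t) * \<beta>\<^sub>1 \<sigma>) *\<^sub>R mat 1"
        unfolding K using K_upper[OF t \<sigma>(2)] by blast
    qed
  qed
  show "nonuniformly_completely_controllable A B"
    unfolding nonuniformly_completely_controllable_def
    by (rule exI[of _ \<mu>], rule exI[of _ 0], rule exI[of _ "\<mu> + \<epsilon>"], rule exI[of _ \<epsilon>],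
        rule exI[of _ \<alpha>], rule exI[of _ \<beta>\<^sub>0], rule exI[of _ \<alpha>\<^sub>1], rule exI[of _ \<beta>\<^sub>1])
       (use \<mu> pos posfun main in auto)
qed

section \<open>Comparison of the Gramians of the two systems\<close>

text \<open>Cauchy-Schwarz against the constant 1, obtained by expanding \<integral> (f - m)^2 \<ge>
  0 with m the mean of \<open>f\<close>.\<close>

lemma integral_power2_le:
  fixes f :: "real \<Rightarrow> real"
  assumes f: "f integrable_on {s..t}" and f2: "(\<lambda>r. (f r)\<^sup>2) integrable_on {s..t}" and "s \<le> t"
  shows "(integral {s..t} f)\<^sup>2 \<le> (t - s) * integral {s..t} (\<lambda>r. (f r)\<^sup>2)"
proof (cases "s = t")
  case False
  define m where "m = integral {s..t} f / (t - s)"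
  have st: "t - s > 0" using False \<open>s \<le> t\<close> by simp
  have "((\<lambda>r. (f r)\<^sup>2 - 2 * m * f r + m\<^sup>2) has_integral
      integral {s..t} (\<lambda>r. (f r)\<^sup>2) - 2 * m * integral {s..t} f + (t - s) *\<^sub>R m\<^sup>2) {s..t}"
    using has_integral_const_real[of "m\<^sup>2" s t] \<open>s \<le> t\<close>
    by (intro has_integral_add has_integral_diff has_integral_mult_right integrable_integral f f2) simp
  moreover have "(f r)\<^sup>2 - 2 * m * f r + m\<^sup>2 \<ge> 0" for r
    using zero_le_power2[of "f r - m"] by (simp add: power2_diff mult_ac)
  ultimately have "0 \<le> integral {s..t} (\<lambda>r. (f r)\<^sup>2) - 2 * m * integral {s..t} f + (t - s) *\<^sub>R m\<^sup>2"
    by (rule has_integral_nonneg)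
  moreover have mean: "integral {s..t} f = m * (t - s)" using st by (simp add: m_def)
  ultimately have "0 \<le> integral {s..t} (\<lambda>r. (f r)\<^sup>2) - m\<^sup>2 * (t - s)"
    by (simp add: power2_eq_square algebra_simps)
  then have "0 \<le> (t - s) * (integral {s..t} (\<lambda>r. (f r)\<^sup>2) - m\<^sup>2 * (t - s))"
    using st by simp
  then show ?thesis
    unfolding mean by (simp add: power2_eq_square algebra_simps)
qed simp

text \<open>Because A - A' = B M, the perturbation integrand contains x \<Phi>'(t,r) B(r), the very
  function whose squared norm integrates to the Gramian of A'. So \<open>u\<close> equals
  \<open>v\<close> minus a Volterra integral of \<open>v\<close>, with kernel M(r) \<Phi>(r,s)
  B(s).\<close>

lemma gramian_W_feedback_le:
  fixes A A' :: "real \<Rightarrow> real^'n^'n" and B :: "real \<Rightarrow> real^'p^'n" and M :: "real \<Rightarrow> real^'n^'p"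
  assumes A: "measurable_locally_bounded A" and A': "measurable_locally_bounded A'"
    and B: "measurable_locally_bounded B"
    and growth: "nonuniform_bounded_growth A K a \<epsilon>"
    and feedback: "\<And>r. r \<ge> 0 \<Longrightarrow> A r - A' r = B r ** M r"
    and Mgrowth: "\<And>z. z \<ge> 0 \<Longrightarrow> matrix_onorm (M z) \<le> c * exp (l * z)"
    and Bdecay: "\<And>z. z \<ge> 0 \<Longrightarrow> matrix_onorm (B z) \<le> b * exp (- \<beta> * z)"
    and const: "c > 0" "b > 0" "l > 0" "\<epsilon> + l \<le> \<beta>"
    and t: "t \<ge> 0" "\<sigma> \<ge> 0"
  shows "x \<bullet> (gramian_W A B t (t + \<sigma>) *v x)
    \<le> (2 + 2 * (b * K * c * exp (a * \<sigma>) * \<sigma>)\<^sup>2) * (x \<bullet> (gramian_W A' B t (t + \<sigma>) *v x))"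
proof -
  have pos: "K > 0" "a > 0" "\<epsilon> > 0"
    using growth by (auto simp: nonuniform_bounded_growth_def)
  interpret vm: bounded_bilinear "(v*) :: real^'n \<Rightarrow> real^'p^'n \<Rightarrow> real^'p"
    by (rule bounded_bilinear_vector_matrix_mult)
  interpret vn: bounded_bilinear "(v*) :: real^'n \<Rightarrow> real^'n^'n \<Rightarrow> real^'n"
    by (rule bounded_bilinear_vector_matrix_mult)
  define u where "u = (\<lambda>s. x v* transition_matrix A t s v* B s)"
  define v where "v = (\<lambda>s. x v* transition_matrix A' t s v* B s)"
  \<comment> \<open>Bound of the Volterra kernel on the window: for r \<le> s the exponent
    \<epsilon> s + l r - \<beta> s is at most 0 by \<epsilon> + l \<le> \<beta>, and a (s - r) \<le>
    a \<sigma>.\<close>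
  define D where "D = b * K * c * exp (a * \<sigma>)"
  define V where "V = x \<bullet> (gramian_W A' B t (t + \<sigma>) *v x)"
  have "D > 0" using pos const by (simp add: D_def)
  have u2: "((\<lambda>s. (norm (u s))\<^sup>2) has_integral x \<bullet> (gramian_W A B t (t + \<sigma>) *v x)) {t..t + \<sigma>}"
    unfolding u_def by (rule gramian_W_quadratic_form[OF A B t(1)])
  have v2: "((\<lambda>s. (norm (v s))\<^sup>2) has_integral V) {t..t + \<sigma>}"
    unfolding v_def V_def by (rule gramian_W_quadratic_form[OF A' B t(1)])
  have mv: "measurable_locally_bounded v"
    unfolding v_def
    by (intro measurable_locally_bounded_bilinear[OF bounded_bilinear_vector_matrix_mult]
        measurable_locally_bounded_continuous continuous_on_const transition_matrix_continuous_on[OF A' t(1)] B)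
  have vint: "(\<lambda>s. norm (v s)) integrable_on {t..s}" for s
  proof -
    have "measurable_locally_bounded (\<lambda>s. norm (v s))"
      using mv unfolding measurable_locally_bounded_def by (auto simp: bounded_iff)
    then show ?thesis using t by (intro measurable_locally_bounded_integrable)
  qed
  \<comment> \<open>Integrated over the whole window, so that the bound on \<open>u s\<close> is
    uniform in s; Cauchy-Schwarz then controls \<open>J\<close> by the Gramian of A'.\<close>
  define J where "J = integral {t..t + \<sigma>} (\<lambda>s. norm (v s))"
  have "J\<^sup>2 \<le> \<sigma> * V"
    using integral_power2_le[OF vint, of "t + \<sigma>"] v2 t by (auto simp: J_def integral_unique has_integral_integrable)
  have u_le: "norm (u s) \<le> norm (v s) + D * J" if s: "s \<in> {t..t + \<sigma>}" for s
  proof -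
    have s': "t \<le> s" "s \<ge> 0" "s \<le> t + \<sigma>" using s t by auto
    let ?g = "\<lambda>r. x v* (transition_matrix A' t r ** (A r - A' r) ** transition_matrix A r s) v* B s"
    have "((\<lambda>r. transition_matrix A' t r ** (A r - A' r) ** transition_matrix A r s) has_integral
        (transition_matrix A' t s - transition_matrix A t s)) {t..s}"
      using transition_matrix_perturbation[OF A A' t(1) s'(2) t(1) s'(1)] s' t
      by (simp add: transition_matrix_self A A')
    from has_integral_linear[OF this bounded_linear_compose[OF vm.bounded_linear_left[of "B s"] vn.bounded_linear_right[of x]]]
    have int: "(?g has_integral (v s - u s)) {t..s}"
      by (simp add: o_def u_def v_def vm.diff_left vn.diff_right)
    have g_le: "norm (?g r) \<le> D * norm (v r)" if r: "r \<in> {t..s}" for r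
    proof -
      have r': "t \<le> r" "r \<le> s" "r \<ge> 0" "s - r \<le> \<sigma>" using r s' t by auto
      \<comment> \<open>The factor B(r) of the perturbation completes x \<Phi>'(t,r) to
        \<open>v r\<close>.\<close>
      have "?g r = ((v r v* M r) v* transition_matrix A r s) v* B s"
        using r' by (simp add: v_def feedback vector_matrix_mul_assoc matrix_mul_assoc)
      also have "norm \<dots> \<le> (b * exp (- \<beta> * s)) * ((K * exp (\<epsilon> * s) * exp (a * (s - r))) *
          ((c * exp (l * r)) * norm (v r)))"
        by (intro norm_matrix_vector_mult_bound norm_vector_matrix_mult_bound Bdecay Mgrowth nonuniform_bounded_growth_forward[OF growth])
           (use r' s' pos const in auto)
      also have "\<dots> = (b * K * c * norm (v r)) * exp (a * (s - r) + (\<epsilon> * s + l * r - \<beta> * s))"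
        by (simp add: exp_add exp_diff exp_minus field_simps)
      also have "\<dots> \<le> (b * K * c * norm (v r)) * exp (a * \<sigma>)"
      proof (intro mult_left_mono)
        have "l * r \<le> l * s" "(\<epsilon> + l) * s \<le> \<beta> * s" "a * (s - r) \<le> a * \<sigma>"
          using r' s' const pos by (auto intro!: mult_left_mono mult_right_mono)
        then show "exp (a * (s - r) + (\<epsilon> * s + l * r - \<beta> * s)) \<le> exp (a * \<sigma>)"
          by (simp add: algebra_simps)
      qed (use pos const in auto)
      finally show ?thesis by (simp add: D_def mult_ac)
    qed
    have "norm (v s - u s) \<le> integral {t..s} (\<lambda>r. D * norm (v r))"
      unfolding integral_unique[OF int, symmetric]
      by (intro Henstock_Kurzweil_Integration.integral_norm_bound_integral)
         (use int g_le vint in \<open>auto intro: integrable_on_mult_right\<close>)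
    also have "\<dots> = D * integral {t..s} (\<lambda>r. norm (v r))" by simp
    also have "\<dots> \<le> D * J"
      unfolding J_def using \<open>D > 0\<close> s'
      by (intro mult_left_mono integral_subset_le vint) auto
    finally show ?thesis using norm_triangle_sub[of "u s" "v s"] by (simp add: norm_minus_commute)
  qed
  \<comment> \<open>Integrate (p + q)^2 \<le> 2 p^2 + 2 q^2; the constant term contributes a factor
    \<sigma>, and J^2 \<le> \<sigma> V contributes another.\<close>
  have "x \<bullet> (gramian_W A B t (t + \<sigma>) *v x) \<le> 2 * V + \<sigma> *\<^sub>R (2 * (D * J)\<^sup>2)"
  proof (rule has_integral_le[OF u2])
    show "((\<lambda>s. 2 * (norm (v s))\<^sup>2 + 2 * (D * J)\<^sup>2) has_integral 2 * V + \<sigma> *\<^sub>R (2 * (D * J)\<^sup>2)) {t..t + \<sigma>}"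
      using has_integral_const_real[of "2 * (D * J)\<^sup>2" t "t + \<sigma>"] t
      by (intro has_integral_add has_integral_mult_right v2) simp
    fix s assume s: "s \<in> {t..t + \<sigma>}"
    have "(norm (u s))\<^sup>2 \<le> (norm (v s) + D * J)\<^sup>2"
      by (intro power_mono u_le s) simp
    also have "\<dots> \<le> 2 * (norm (v s))\<^sup>2 + 2 * (D * J)\<^sup>2"
      using zero_le_power2[of "norm (v s) - D * J"] by (simp add: power2_sum power2_diff)
    finally show "(norm (u s))\<^sup>2 \<le> 2 * (norm (v s))\<^sup>2 + 2 * (D * J)\<^sup>2" .
  qed
  also have "\<sigma> *\<^sub>R (2 * (D * J)\<^sup>2) = (2 * \<sigma> * D\<^sup>2) * J\<^sup>2" by (simp add: power_mult_distrib)
  also have "\<dots> \<le> (2 * \<sigma> * D\<^sup>2) * (\<sigma> * V)"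
    using \<open>J\<^sup>2 \<le> \<sigma> * V\<close> t by (intro mult_left_mono) auto
  also have "2 * V + (2 * \<sigma> * D\<^sup>2) * (\<sigma> * V) = (2 + 2 * (D * \<sigma>)\<^sup>2) * V"
    by (simp add: power_mult_distrib power2_eq_square algebra_simps)
  finally show ?thesis by (simp add: V_def D_def)
qed

text \<open>The comparison factor depends on \<sigma> alone, so it is absorbed into \<alpha>, while
  \<mu> and the thresholds stay the same.\<close>

lemma gramian_W_bounded_below_feedback:
  fixes A A' :: "real \<Rightarrow> real^'n^'n" and B :: "real \<Rightarrow> real^'p^'n" and M :: "real \<Rightarrow> real^'n^'p"
  assumes "measurable_locally_bounded A" "measurable_locally_bounded A'" "measurable_locally_bounded B"
    and "nonuniform_bounded_growth A K a \<epsilon>"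
    and "\<And>r. r \<ge> 0 \<Longrightarrow> A r - A' r = B r ** M r"
    and "\<And>z. z \<ge> 0 \<Longrightarrow> matrix_onorm (M z) \<le> c * exp (l * z)"
    and "\<And>z. z \<ge> 0 \<Longrightarrow> matrix_onorm (B z) \<le> b * exp (- \<beta> * z)"
    and "c > 0" "b > 0" "l > 0" "\<epsilon> + l \<le> \<beta>"
    and below: "gramian_W_bounded_below A B"
  shows "gramian_W_bounded_below A' B"
proof -
  define q where "q = (\<lambda>\<sigma>. 2 + 2 * (b * K * c * exp (a * \<sigma>) * \<sigma>)\<^sup>2)"
  have q: "q \<sigma> > 0" for \<sigma>
    unfolding q_def using zero_le_power2[of "b * K * c * exp (a * \<sigma>) * \<sigma>"] by linarith
  obtain \<mu> \<alpha> where \<mu>: "\<mu> \<ge> 0" and \<alpha>: "\<And>\<sigma>. \<sigma> \<ge> 0 \<Longrightarrow> \<alpha> \<sigma> > 0"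
    and lower: "\<And>t. t \<ge> 0 \<Longrightarrow> \<exists>\<sigma>\<^sub>0>0. \<forall>\<sigma>\<ge>\<sigma>\<^sub>0. \<forall>x.
        exp (- 2 * \<mu> * t) * \<alpha> \<sigma> * (norm x)\<^sup>2 \<le> x \<bullet> (gramian_W A B t (t + \<sigma>) *v x)"
    using below unfolding gramian_W_bounded_below_def by blast
  have "\<exists>\<sigma>\<^sub>0>0. \<forall>\<sigma>\<ge>\<sigma>\<^sub>0. \<forall>x.
      exp (- 2 * \<mu> * t) * (\<alpha> \<sigma> / q \<sigma>) * (norm x)\<^sup>2 \<le> x \<bullet> (gramian_W A' B t (t + \<sigma>) *v x)"
    if t: "t \<ge> 0" for t
  proof -
    obtain \<sigma>\<^sub>0 where \<sigma>\<^sub>0: "\<sigma>\<^sub>0 > 0" "\<And>\<sigma> x. \<sigma> \<ge> \<sigma>\<^sub>0 \<Longrightarrow>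
        exp (- 2 * \<mu> * t) * \<alpha> \<sigma> * (norm x)\<^sup>2 \<le> x \<bullet> (gramian_W A B t (t + \<sigma>) *v x)"
      using lower[OF t] by blast
    have "exp (- 2 * \<mu> * t) * (\<alpha> \<sigma> / q \<sigma>) * (norm x)\<^sup>2 \<le> x \<bullet> (gramian_W A' B t (t + \<sigma>) *v x)"
      if \<sigma>: "\<sigma> \<ge> \<sigma>\<^sub>0" for \<sigma> x
    proof -
      have "exp (- 2 * \<mu> * t) * \<alpha> \<sigma> * (norm x)\<^sup>2 \<le> q \<sigma> * (x \<bullet> (gramian_W A' B t (t + \<sigma>) *v x))"
        unfolding q_def using \<sigma> \<sigma>\<^sub>0(1)
        by (intro order_trans[OF \<sigma>\<^sub>0(2)[OF \<sigma>] gramian_W_feedback_le[OF assms(1-11) t]]) auto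
      then show ?thesis using q[of \<sigma>] by (simp add: pos_divide_le_eq mult_ac)
    qed
    then show ?thesis using \<sigma>\<^sub>0(1) by blast
  qed
  then show ?thesis
    unfolding gramian_W_bounded_below_def using \<mu> \<alpha> q
    by (intro exI[of _ \<mu>] conjI exI[of _ "\<lambda>\<sigma>. \<alpha> \<sigma> / q \<sigma>"]) auto
qed

section \<open>Application to the feedback system\<close>

text \<open>Supplies local boundedness of the gain \<open>L\<close>. Each entry is at most the
  operator norm, and the Frobenius norm is at most the sum of the absolute values of the
  entries.\<close>

lemma measurable_locally_bounded_exponential_growth:
  fixes M :: "real \<Rightarrow> real^'k^'m"
  assumes "measurable_halfline M" and le: "\<And>z. z \<ge> 0 \<Longrightarrow> matrix_onorm (M z) \<le> c * exp (l * z)"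
    and "c > 0" "l > 0"
  shows "measurable_locally_bounded M"
  unfolding measurable_locally_bounded_def
proof safe
  show "M \<in> borel_measurable (lebesgue_on {0..})"
    using assms(1) by (simp add: measurable_halfline_def)
  fix T :: real assume "T \<ge> 0"
  have "norm (M z) \<le> real CARD('m) * real CARD('k) * (c * exp (l * T))" if "z \<in> {0..T}" for z
  proof -
    have entry: "\<bar>M z $ i $ j\<bar> \<le> c * exp (l * T)" for i j
    proof -
      have "\<bar>M z $ i $ j\<bar> \<le> c * exp (l * z)"
        using matrix_component_le_onorm[of "M z" i j] le[of z] that by auto
      also have "\<dots> \<le> c * exp (l * T)" using that assms by simp
      finally show ?thesis .
    qed
    have "norm (M z) \<le> (\<Sum>i\<in>UNIV. norm (M z $ i))"
      by (simp add: norm_vec_def L2_set_le_sum)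
    also have "\<dots> \<le> (\<Sum>i\<in>UNIV. \<Sum>j\<in>UNIV. \<bar>M z $ i $ j\<bar>)"
      by (intro sum_mono norm_le_l1_cart)
    also have "\<dots> \<le> (\<Sum>i\<in>(UNIV :: 'm set). \<Sum>j\<in>(UNIV :: 'k set). c * exp (l * T))"
      by (intro sum_mono entry)
    finally show ?thesis by simp
  qed
  then show "bounded (M ` {0..T})"
    by (auto simp: bounded_iff intro!: exI[of _ "real CARD('m) * real CARD('k) * (c * exp (l * T))"])
qed

lemma matrix_onorm_mult_le: "matrix_onorm (M ** N) \<le> matrix_onorm M * matrix_onorm N"
  using onorm_compose[of "(*v) M" "(*v) N"] by (simp add: o_def matrix_vector_mul_assoc)

lemma matrix_onorm_minus: "matrix_onorm (- M) = matrix_onorm M"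
proof -
  have "matrix_onorm (- M) = onorm (\<lambda>x. - (M *v x))"
    by (rule arg_cong[of _ _ onorm])
       (simp add: fun_eq_iff bounded_bilinear.minus_left[OF bounded_bilinear_matrix_vector_mult])
  then show ?thesis by (simp only: onorm_neg)
qed

theorem theorem4p2:
  fixes A :: "real \<Rightarrow> real^'n^'n"
    and B :: "real \<Rightarrow> real^'p^'n"
    and L :: "real \<Rightarrow> real^'n^'p"
    and K\<^sub>0 a \<epsilon> \<L> l \<B> \<beta> :: real
  assumes "measurable_halfline A" and "locally_bounded_halfline A"
    and "measurable_halfline B" and "locally_bounded_halfline B"
    and "measurable_halfline L"
    and "K\<^sub>0 > 0" and "a > 0" and "\<epsilon> > 0"
    and "nonuniform_bounded_growth A K\<^sub>0 a \<epsilon>"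
    and "\<L> > 0" and "l > 0" and "\<B> > 0" and "\<beta> > 0"
    and "\<And>z. z \<ge> 0 \<Longrightarrow> matrix_onorm (transpose (L z)) \<le> \<L> * exp (l * z)"
    and "\<And>z. z \<ge> 0 \<Longrightarrow> matrix_onorm (transpose (B z)) \<le> \<B> * exp (- \<beta> * z)"
    and "\<beta> - (\<epsilon> + l) > 0"
  shows "nonuniformly_completely_controllable A B \<longleftrightarrow>
         nonuniformly_completely_controllable (\<lambda>t. A t - B t ** L t) B"
proof -
  let ?A = "\<lambda>t. A t - B t ** L t"
  \<comment> \<open>The slack in the decay hypothesis: the product B L decays at the rate \<beta> -
    l = \<epsilon> + \<gamma>, as the growth perturbation lemma requires.\<close>
  define \<gamma> where "\<gamma> = \<beta> - (\<epsilon> + l)"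
  \<comment> \<open>The second bound serves the converse direction, where the original system is
    recovered by the feedback gain \<open>- L\<close>.\<close>
  have L: "matrix_onorm (L z) \<le> \<L> * exp (l * z)" "matrix_onorm (- L z) \<le> \<L> * exp (l * z)" if "z \<ge> 0" for z
    using assms(14)[OF that] by (simp_all add: matrix_onorm_transpose matrix_onorm_minus)
  have B: "matrix_onorm (B z) \<le> \<B> * exp (- \<beta> * z)" if "z \<ge> 0" for z
    using assms(15)[OF that] by (simp add: matrix_onorm_transpose)
  have mA: "measurable_locally_bounded A" and mB: "measurable_locally_bounded B"
    using assms(1-4)
    by (auto simp: measurable_locally_bounded_def measurable_halfline_def locally_bounded_halfline_def)
  have mL: "measurable_locally_bounded L"
    by (rule measurable_locally_bounded_exponential_growth[OF assms(5) L(1) assms(10,11)])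
  have "measurable_locally_bounded (\<lambda>t. A t + - (B t ** L t))"
    by (intro measurable_locally_bounded_add mA measurable_locally_bounded_bilinear[OF bounded_bilinear_matrix_matrix_mult mB mL]
        measurable_locally_bounded_linear[of uminus] bounded_linear_minus bounded_linear_ident)
  then have mA': "measurable_locally_bounded ?A" by simp
  \<comment> \<open>The closed-loop system keeps the same a and \<epsilon>, so it satisfies the same
    inequalities with \<beta> as the plant and the roles of the two systems can be
    exchanged.\<close>
  have growth': "nonuniform_bounded_growth ?A (K\<^sub>0 * exp (K\<^sub>0 * (\<B> * \<L>) / \<gamma>)) a \<epsilon>"
  proof (rule nonuniform_bounded_growth_perturbation[OF mA mA' assms(9)])
    fix r :: real assume r: "r \<ge> 0"
    have "matrix_onorm (A r - ?A r) \<le> matrix_onorm (B r) * matrix_onorm (L r)"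
      by (simp add: matrix_onorm_mult_le)
    also have "\<dots> \<le> (\<B> * exp (- \<beta> * r)) * (\<L> * exp (l * r))"
      using assms(12) by (intro mult_mono B L r) (auto simp: onorm_pos_le)
    also have "\<dots> = \<B> * \<L> * exp (- (\<epsilon> + \<gamma>) * r)"
      by (simp add: \<gamma>_def exp_add[symmetric] algebra_simps)
    finally show "matrix_onorm (A r - ?A r) \<le> \<B> * \<L> * exp (- (\<epsilon> + \<gamma>) * r)" .
  qed (use assms(10,12,16) in \<open>auto simp: \<gamma>_def\<close>)
  have le: "\<epsilon> + l \<le> \<beta>" "\<epsilon> \<le> \<beta>" using assms(11,16) by auto
  have "gramian_W_bounded_below A B \<longleftrightarrow> gramian_W_bounded_below ?A B"
  proof
    have feedback: "A r - ?A r = B r ** L r" "?A r - A r = B r ** (- L r)" for r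
      by (simp_all add: bounded_bilinear.minus_right[OF bounded_bilinear_matrix_matrix_mult])
    show "gramian_W_bounded_below ?A B" if "gramian_W_bounded_below A B"
      by (rule gramian_W_bounded_below_feedback[OF mA mA' mB assms(9) feedback(1) L(1) B
            assms(10,12,11) le(1) that])
    show "gramian_W_bounded_below A B" if "gramian_W_bounded_below ?A B"
      by (rule gramian_W_bounded_below_feedback[OF mA' mA mB growth' feedback(2) L(2) B
            assms(10,12,11) le(1) that])
  qed
  then show ?thesis
    using nonuniformly_completely_controllable_iff[OF mA mB assms(9) B assms(12) le(2)]
      nonuniformly_completely_controllable_iff[OF mA' mB growth' B assms(12) le(2)] by simp
qed

end
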